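(* Let $K:[0,1]^2\to\mathbb{R}$ be continuous with $\min_{t,s\in[0,1]}|K(t,s)|\neq 0$. Let $W(t)$, $t\in[0,1]$, be a one-dimensional Wiener process and let $X(t)=\int_0^tK(t,s)\,\mathrm{d}W(s)$, $t\in[0,1]$. Then the local time $l^X(t,y)$ of the process $X$ exists at every point $y\in\mathbb{R}$, for all $t\in[0,1]$.
   Context: For $\varepsilon>0$ and $y,z\in\mathbb{R}$ let $f_{\varepsilon,y}(z)=\frac{1}{(2\pi\varepsilon)^{1/2}}\exp\left(-\frac{(z-y)^2}{2\varepsilon}\right)$. For a real-valued process $x(t)$, $t\in[0,1]$, put $l^x_\varepsilon(t,y)=\int_0^tf_{\varepsilon,y}(x(s))\,\mathrm{d}s$. The local time of $x$ at $y$ up to time $t$ is the random variable $l^x(t,y)=\lim_{\varepsilon\to0}l^x_\varepsilon(t,y)$, the limit being taken in $L_2$ (mean square); the local time is said to exist when this limit exists. Here $X$ is taken with a jointly measurable version so that these integrals make sense. *)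

theory Defs
  imports "HOL-Probability.Probability"
begin

definition square_integrable :: "'b measure \<Rightarrow> ('b \<Rightarrow> real) \<Rightarrow> bool" where
  "square_integrable M f \<longleftrightarrow> f \<in> borel_measurable M \<and> integrable M (\<lambda>x. (f x)\<^sup>2)"

text \<open>
  Convergence in the mean square. Square integrability is required explicitly because the
  Bochner integral of a non-integrable function is \<open>0\<close>.
\<close>

definition L2_tendsto ::
  "'b measure \<Rightarrow> ('i \<Rightarrow> 'b \<Rightarrow> real) \<Rightarrow> ('b \<Rightarrow> real) \<Rightarrow> 'i filter \<Rightarrow> bool" where
  "L2_tendsto M f g F \<longleftrightarrow>
     (\<forall>\<^sub>F i in F. square_integrable M (f i)) \<and> square_integrable M g \<and>
     ((\<lambda>i. \<integral>x. (f i x - g x)\<^sup>2 \<partial>M) \<longlongrightarrow> 0) F"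

definition partition_points :: "real \<Rightarrow> real \<Rightarrow> nat \<Rightarrow> (nat \<Rightarrow> real) \<Rightarrow> bool" where
  "partition_points a b n p \<longleftrightarrow> strict_mono_on {..n} p \<and> p ` {..n} \<subseteq> {a..b}"

text \<open>
  A one-dimensional Wiener process with time set \<open>[0,1]\<close>; the values of \<open>W\<close> at other times
  are irrelevant.
\<close>

locale wiener_process = prob_space M
  for M :: "'a measure" and W :: "real \<Rightarrow> 'a \<Rightarrow> real" +
  assumes random_variable_W: "\<And>t. t \<in> {0..1} \<Longrightarrow> random_variable borel (W t)"
    and starts_at_0: "AE \<omega> in M. W 0 \<omega> = 0"
    and independent_increments: "\<And>n p. partition_points 0 1 n p \<Longrightarrow>
      indep_vars (\<lambda>_. borel) (\<lambda>i \<omega>. W (p (Suc i)) \<omega> - W (p i) \<omega>) {..<n}"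
    and normal_increments: "\<And>s t. 0 \<le> s \<Longrightarrow> s < t \<Longrightarrow> t \<le> 1 \<Longrightarrow>
      distributed M lborel (\<lambda>\<omega>. W t \<omega> - W s \<omega>) (normal_density 0 (sqrt (t - s)))"
    and continuous_paths: "AE \<omega> in M. continuous_on {0..1} (\<lambda>t. W t \<omega>)"

definition step_function :: "nat \<Rightarrow> (nat \<Rightarrow> real) \<Rightarrow> (nat \<Rightarrow> real) \<Rightarrow> real \<Rightarrow> real" where
  "step_function n p c s = (\<Sum>i<n. c i * indicator {p i<..p (Suc i)} s)"

definition step_integral ::
  "(real \<Rightarrow> 'a \<Rightarrow> real) \<Rightarrow> nat \<Rightarrow> (nat \<Rightarrow> real) \<Rightarrow> (nat \<Rightarrow> real) \<Rightarrow> 'a \<Rightarrow> real" where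
  "step_integral W n p c \<omega> = (\<Sum>i<n. c i * (W (p (Suc i)) \<omega> - W (p i) \<omega>))"

text \<open>
  \<open>wiener_integral M W a b f I\<close>: the random variable \<open>I\<close> is (a version of) the Wiener integral
  of \<open>f \<in> L\<^sub>2[a,b]\<close>, the \<open>L\<^sub>2\<close>-limit of the integrals of step functions approximating \<open>f\<close> in
  \<open>L\<^sub>2[a,b]\<close>. By the Wiener isometry \<open>I\<close> exists, does not depend on the approximating sequence,
  and is determined up to almost sure equality; hence a relation rather than a function.
\<close>

definition wiener_integral ::
  "'a measure \<Rightarrow> (real \<Rightarrow> 'a \<Rightarrow> real) \<Rightarrow> real \<Rightarrow> real \<Rightarrow> (real \<Rightarrow> real) \<Rightarrow> ('a \<Rightarrow> real) \<Rightarrow> bool" where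
  "wiener_integral M W a b f I \<longleftrightarrow>
     (\<exists>n p c. (\<forall>k. partition_points a b (n k) (p k)) \<and>
        L2_tendsto (restrict_space lborel {a..b})
          (\<lambda>k. step_function (n k) (p k) (c k)) f sequentially \<and>
        L2_tendsto M (\<lambda>k. step_integral W (n k) (p k) (c k)) I sequentially)"

definition gauss_kernel :: "real \<Rightarrow> real \<Rightarrow> real \<Rightarrow> real" where
  "gauss_kernel \<epsilon> y z = 1 / sqrt (2 * pi * \<epsilon>) * exp (- (z - y)\<^sup>2 / (2 * \<epsilon>))"

lemma gauss_kernel_eq_normal_density:
  "\<epsilon> > 0 \<Longrightarrow> gauss_kernel \<epsilon> y z = normal_density y (sqrt \<epsilon>) z"
  by (simp add: gauss_kernel_def normal_density_def)

definition approx_local_time ::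
  "(real \<Rightarrow> 'a \<Rightarrow> real) \<Rightarrow> real \<Rightarrow> real \<Rightarrow> real \<Rightarrow> 'a \<Rightarrow> real" where
  "approx_local_time X \<epsilon> t y \<omega> = (LINT s:{0..t}|lborel. gauss_kernel \<epsilon> y (X s \<omega>))"

definition is_local_time ::
  "'a measure \<Rightarrow> (real \<Rightarrow> 'a \<Rightarrow> real) \<Rightarrow> real \<Rightarrow> real \<Rightarrow> ('a \<Rightarrow> real) \<Rightarrow> bool" where
  "is_local_time M X t y L \<longleftrightarrow>
     L2_tendsto M (\<lambda>\<epsilon>. approx_local_time X \<epsilon> t y) L (at_right 0)"

definition local_time_exists ::
  "'a measure \<Rightarrow> (real \<Rightarrow> 'a \<Rightarrow> real) \<Rightarrow> real \<Rightarrow> real \<Rightarrow> bool" where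
  "local_time_exists M X t y \<longleftrightarrow> (\<exists>L. is_local_time M X t y L)"

end

theory Submission
  imports Defs
begin

text \<open>
  Write the Gaussian kernel as a Fourier integral. The second moment of the difference of two
  approximate local times is then a double time integral of integrals over frequencies
  \<open>(\<xi>, \<eta>)\<close> of \<open>\<bar>\<phi> \<xi>\<bar> \<bar>\<phi> \<eta>\<bar>\<close> times the characteristic function of \<open>(X t, X s)\<close>, which is
  \<open>exp (- Q / 2)\<close> with \<open>Q\<close> the squared \<open>L\<^sub>2\<close> norm of
  \<open>\<xi> K(t, \<cdot>) 1\<^bsub>[0,t]\<^esub> + \<eta> K(s, \<cdot>) 1\<^bsub>[0,s]\<^esub>\<close>. For \<open>s < t\<close> and \<open>\<bar>K\<bar> \<ge> m\<close>, Cauchy-Schwarz on \<open>[0,s]\<close>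
  gives \<open>Q \<ge> m\<^sup>2 s (\<eta> + \<beta> \<xi>)\<^sup>2 + m\<^sup>2 (t - s) \<xi>\<^sup>2\<close> for some \<open>\<beta>\<close>. Here \<open>\<bar>\<phi> \<xi>\<bar> \<le> min 1 (\<delta> \<xi>\<^sup>2)\<close>, where \<open>\<delta>\<close> is
  the larger of the two approximation parameters, so the frequency integral is at most a multiple
  of \<open>\<delta>\<close> to the power \<open>1/4\<close> times \<open>s\<close> to the power \<open>-1/2\<close> times \<open>t - s\<close> to the power \<open>-3/4\<close>,
  which is integrable over \<open>0 < s < t < 1\<close>. Hence the approximate local times are Cauchy in mean square.
\<close>

section \<open>Step functions and their Wiener integrals\<close>

text \<open>The increment telescopes over the consecutive points of \<open>S\<close> between
  \<open>x\<close> and \<open>y\<close>. The coefficients are fixed before \<open>V\<close>, so they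
  serve alike for paths of \<open>W\<close>, which give step integrals, and for indicators of
  half-lines, which give step functions.\<close>

lemma increment_refine:
  fixes S :: "real set"
  assumes "finite S" "x \<in> S" "y \<in> S" "x \<le> y"
  shows "\<exists>d. \<forall>V :: real \<Rightarrow> real. V y - V x = (\<Sum>k<card S - 1. d k *
    (V (sorted_list_of_set S ! Suc k) - V (sorted_list_of_set S ! k)))"
proof -
  let ?l = "sorted_list_of_set S"
  have l: "set ?l = S" "sorted_wrt (<) ?l" "length ?l = card S"
    using assms(1) by auto
  obtain i where i: "i < card S" "?l ! i = x" using l assms(2) by (metis in_set_conv_nth)
  obtain j where j: "j < card S" "?l ! j = y" using l assms(3) by (metis in_set_conv_nth)
  have ij: "i \<le> j"
    using i j l assms(4) sorted_wrt_nth_less[OF l(2), of j i] by (cases "i \<le> j") auto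
  show ?thesis
  proof (intro exI[of _ "indicator {i..<j}"] allI)
    fix V :: "real \<Rightarrow> real"
    have "(\<Sum>k<card S - 1. indicator {i..<j} k * (V (?l ! Suc k) - V (?l ! k)))
        = (\<Sum>k\<in>{i..<j}. V (?l ! Suc k) - V (?l ! k))"
      using j by (intro sum.mono_neutral_cong_right) (auto simp: indicator_def)
    also have "\<dots> = V y - V x"
      using sum_Suc_diff'[OF ij, of "\<lambda>k. V (?l ! k)"] i j by simp
    finally show "V y - V x =
      (\<Sum>k<card S - 1. indicator {i..<j} k * (V (?l ! Suc k) - V (?l ! k)))" by simp
  qed
qed

lemma increments_refine:
  fixes S :: "real set" and p c :: "nat \<Rightarrow> real"
  assumes "finite S" "p ` {..n} \<subseteq> S" "strict_mono_on {..n} p"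
  shows "\<exists>d. \<forall>V :: real \<Rightarrow> real. (\<Sum>i<n. c i * (V (p (Suc i)) - V (p i))) =
    (\<Sum>k<card S - 1. d k * (V (sorted_list_of_set S ! Suc k) - V (sorted_list_of_set S ! k)))"
proof -
  have "\<exists>d. \<forall>V :: real \<Rightarrow> real. V (p (Suc i)) - V (p i) = (\<Sum>k<card S - 1. d k *
    (V (sorted_list_of_set S ! Suc k) - V (sorted_list_of_set S ! k)))" if "i < n" for i
    using that assms strict_mono_onD[OF assms(3), of i "Suc i"]
    by (intro increment_refine) auto
  then have "\<forall>i. \<exists>d. i < n \<longrightarrow> (\<forall>V :: real \<Rightarrow> real. V (p (Suc i)) - V (p i) = (\<Sum>k<card S - 1. d k *
    (V (sorted_list_of_set S ! Suc k) - V (sorted_list_of_set S ! k))))" by blast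
  from choice[OF this] obtain d where d: "V (p (Suc i)) - V (p i) = (\<Sum>k<card S - 1. d i k *
    (V (sorted_list_of_set S ! Suc k) - V (sorted_list_of_set S ! k)))"
    if "i < n" for i and V :: "real \<Rightarrow> real"
    by blast
  show ?thesis
  proof (intro exI[of _ "\<lambda>k. \<Sum>i<n. c i * d i k"] allI)
    fix V :: "real \<Rightarrow> real"
    have "(\<Sum>i<n. c i * (V (p (Suc i)) - V (p i))) =
      (\<Sum>i<n. \<Sum>k<card S - 1. c i * d i k *
        (V (sorted_list_of_set S ! Suc k) - V (sorted_list_of_set S ! k)))"
      by (simp add: d sum_distrib_left mult.assoc)
    also have "\<dots> = (\<Sum>k<card S - 1. \<Sum>i<n. c i * d i k *
        (V (sorted_list_of_set S ! Suc k) - V (sorted_list_of_set S ! k)))"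
      by (rule sum.swap)
    finally show "(\<Sum>i<n. c i * (V (p (Suc i)) - V (p i))) = (\<Sum>k<card S - 1. (\<Sum>i<n. c i * d i k) *
        (V (sorted_list_of_set S ! Suc k) - V (sorted_list_of_set S ! k)))"
      by (simp add: sum_distrib_right)
  qed
qed

text \<open>Both sums are rewritten over the common refinement formed by all points of
  \<open>p\<close> and \<open>q\<close>. As the coefficients do not depend on \<open>V\<close>, a
  linear combination of two step functions and the same combination of their integrals are then
  described by one partition.\<close>

lemma merge_partitions:
  fixes c d :: "nat \<Rightarrow> real"
  assumes "partition_points a b n p" "partition_points a b m q"
  shows "\<exists>N r e f. partition_points a b N r \<and>
    (\<forall>V :: real \<Rightarrow> real. (\<Sum>i<n. c i * (V (p (Suc i)) - V (p i))) = (\<Sum>k<N. e k * (V (r (Suc k)) - V (r k)))) \<and>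
    (\<forall>V :: real \<Rightarrow> real. (\<Sum>i<m. d i * (V (q (Suc i)) - V (q i))) = (\<Sum>k<N. f k * (V (r (Suc k)) - V (r k))))"
proof -
  define S where "S = p ` {..n} \<union> q ` {..m}"
  let ?l = "sorted_list_of_set S"
  have S: "finite S" "S \<subseteq> {a..b}" "S \<noteq> {}"
    using assms by (auto simp: S_def partition_points_def)
  \<comment> \<open>\<open>S\<close> is nonempty because it contains \<open>p 0\<close>; its
    \<open>card S\<close> points bound \<open>card S - 1\<close> intervals.\<close>
  then have c0: "card S > 0" by (simp add: card_gt_0_iff)
  obtain e where e: "\<And>V :: real \<Rightarrow> real. (\<Sum>i<n. c i * (V (p (Suc i)) - V (p i))) =
    (\<Sum>k<card S - 1. e k * (V (?l ! Suc k) - V (?l ! k)))"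
    using increments_refine[of S p n c] S assms by (auto simp: partition_points_def S_def)
  obtain f where f: "\<And>V :: real \<Rightarrow> real. (\<Sum>i<m. d i * (V (q (Suc i)) - V (q i))) =
    (\<Sum>k<card S - 1. f k * (V (?l ! Suc k) - V (?l ! k)))"
    using increments_refine[of S q m d] S assms by (auto simp: partition_points_def S_def)
  have "partition_points a b (card S - 1) (\<lambda>k. ?l ! k)"
    unfolding partition_points_def
  proof (intro conjI strict_mono_onI)
    show "?l ! k < ?l ! l" if "k \<in> {..card S - 1}" "l \<in> {..card S - 1}" "k < l" for k l
      using that c0 by (intro sorted_wrt_nth_less[of "(<)" ?l]) auto
    show "(!) ?l ` {..card S - 1} \<subseteq> {a..b}"
    proof safe
      fix k assume "k \<le> card S - 1"
      then have "?l ! k \<in> set ?l" using c0 by (intro nth_mem) auto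
      then show "?l ! k \<in> {a..b}" using S by auto
    qed
  qed
  then show ?thesis
    by (intro exI[of _ "card S - 1"] exI[of _ "\<lambda>k. ?l ! k"] exI[of _ e] exI[of _ f] conjI allI e f)
qed

lemma partition_points_mono:
  assumes "partition_points a b n p" "i < n"
  shows "p i < p (Suc i)" "a \<le> p i" "p i \<le> b" "a \<le> p (Suc i)" "p (Suc i) \<le> b"
  using assms strict_mono_onD[of "{..n}" p i "Suc i"] by (auto simp: partition_points_def image_subset_iff)

lemma partition_points_subset:
  assumes "partition_points a b n p" "a' \<le> a" "b \<le> b'"
  shows "partition_points a' b' n p"
  using assms by (fastforce simp: partition_points_def)


text \<open>The indicator of a half-open interval is a difference of two half-line indicators, so
  the step function at \<open>s\<close> is a sum of increments of
  \<open>V = indicator {s..}\<close>. This is the form that \<open>merge_partitions\<close>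
  handles.\<close>

lemma step_function_eq_increments:
  assumes "partition_points a b n p"
  shows "step_function n p c s = (\<Sum>i<n. c i * (indicator {s..} (p (Suc i)) - indicator {s..} (p i)))"
  unfolding step_function_def
  using partition_points_mono(1)[OF assms]
  by (intro sum.cong) (force simp: indicator_def)+

lemma step_function_outside:
  assumes "partition_points a b n p" "s \<notin> {a..b}"
  shows "step_function n p c s = 0"
  unfolding step_function_def
  using partition_points_mono[OF assms(1)] assms(2)
  by (intro sum.neutral ballI) (force simp: indicator_def)

text \<open>The intervals are pairwise disjoint, so all cross terms of the squared sum
  vanish.\<close>

lemma step_function_square:
  assumes "partition_points a b n p"
  shows "(step_function n p c s)\<^sup>2 = (\<Sum>i<n. (c i)\<^sup>2 * indicator {p i<..p (Suc i)} s)"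
proof -
  have disj: "indicator {p i<..p (Suc i)} s * indicator {p j<..p (Suc j)} s = (0::real)"
    if "i < j" "j < n" for i j
  proof -
    have "p (Suc i) \<le> p j"
      using assms that strict_mono_on_leD[of "{..n}" p "Suc i" j] by (auto simp: partition_points_def)
    then show ?thesis by (auto simp: indicator_def)
  qed
  have disj': "indicator {p i<..p (Suc i)} s * indicator {p j<..p (Suc j)} s = (0::real)"
    if "i \<noteq> j" "i < n" "j < n" for i j
    using disj[of i j] disj[of j i] that by (cases "i < j") (auto simp: mult.commute)
  have "(step_function n p c s)\<^sup>2 = (\<Sum>i<n. \<Sum>j<n. (c i * indicator {p i<..p (Suc i)} s) * (c j * indicator {p j<..p (Suc j)} s))"
    unfolding step_function_def power2_eq_square sum_product ..
  also have "\<dots> = (\<Sum>i<n. \<Sum>j<n. if j = i then (c i)\<^sup>2 * indicator {p i<..p (Suc i)} s else 0)"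
    using disj' by (intro sum.cong refl) (auto simp: power2_eq_square indicator_def)
  finally show ?thesis by simp
qed

lemma step_function_square_integral:
  assumes "partition_points a b n p"
  shows "has_bochner_integral lborel (\<lambda>s. (step_function n p c s)\<^sup>2) (\<Sum>i<n. (c i)\<^sup>2 * (p (Suc i) - p i))"
  unfolding step_function_square[OF assms]
proof (intro has_bochner_integral_sum has_bochner_integral_mult_right)
  fix i assume "i \<in> {..<n}"
  then show "has_bochner_integral lborel (indicator {p i<..p (Suc i)}) (p (Suc i) - p i)"
    using partition_points_mono(1)[OF assms, of i]
      has_bochner_integral_real_indicator[of "{p i<..p (Suc i)}" lborel] by simp
qed

section \<open>Characteristic functions of step integrals\<close>

context wiener_process begin

text \<open>Dividing by the standard deviation reduces the claim to the characteristic function of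
  the standard normal law.\<close>

lemma char_increment:
  assumes "0 \<le> s" "s < t" "t \<le> 1"
  shows "(\<integral>\<omega>. iexp (c * (W t \<omega> - W s \<omega>)) \<partial>M) = exp (- (c\<^sup>2 * (t - s)) / 2)"
proof -
  let ?\<sigma> = "sqrt (t - s)"
  have \<sigma>: "?\<sigma> > 0" using assms by simp
  have [measurable]: "W t \<in> borel_measurable M" "W s \<in> borel_measurable M"
    using assms random_variable_W by auto
  have "distributed M lborel (\<lambda>\<omega>. (W t \<omega> - W s \<omega> - 0) / ?\<sigma>) std_normal_density"
    using normal_standard_normal_convert[OF \<sigma>, of "\<lambda>\<omega>. W t \<omega> - W s \<omega>" 0] normal_increments[OF assms] by simp
  then have d: "distr M lborel (\<lambda>\<omega>. (W t \<omega> - W s \<omega>) / ?\<sigma>) = std_normal_distribution"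
    by (simp add: distributed_def)
  have "(\<integral>\<omega>. iexp (c * (W t \<omega> - W s \<omega>)) \<partial>M) = (\<integral>\<omega>. iexp ((c * ?\<sigma>) * ((W t \<omega> - W s \<omega>) / ?\<sigma>)) \<partial>M)"
    using \<sigma> by simp
  also have "\<dots> = (\<integral>x. iexp ((c * ?\<sigma>) * x) \<partial>distr M lborel (\<lambda>\<omega>. (W t \<omega> - W s \<omega>) / ?\<sigma>))"
    by (subst integral_distr) auto
  also have "\<dots> = char std_normal_distribution (c * ?\<sigma>)"
    unfolding d char_def ..
  also have "\<dots> = exp (- (c\<^sup>2 * (t - s)) / 2)"
    using assms by (simp add: char_std_normal_distribution power_mult_distrib)
  finally show ?thesis .
qed

text \<open>Independence turns the characteristic function into a product, and the exponents of the
  factors add up to the squared norm of the step function: the Wiener isometry at the level of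
  characteristic functions.\<close>

lemma char_step_integral:
  assumes "partition_points 0 1 n p"
  shows "(\<integral>\<omega>. iexp (step_integral W n p c \<omega>) \<partial>M) = exp (- (\<integral>s. (step_function n p c s)\<^sup>2 \<partial>lborel) / 2)"
proof -
  note pm = partition_points_mono[OF assms]
  have ind: "indep_vars (\<lambda>_. borel) (\<lambda>i \<omega>. c i * (W (p (Suc i)) \<omega> - W (p i) \<omega>)) {..<n}"
    by (rule indep_vars_compose2[OF independent_increments[OF assms]]) auto
  have [measurable]: "(\<lambda>\<omega>. c i * (W (p (Suc i)) \<omega> - W (p i) \<omega>)) \<in> borel_measurable M" if "i < n" for i
    using ind that by (auto simp: indep_vars_def)
  have m: "step_integral W n p c \<in> borel_measurable M"
    unfolding step_integral_def by (intro borel_measurable_sum) auto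
  have "(\<integral>\<omega>. iexp (step_integral W n p c \<omega>) \<partial>M) = char (distr M borel (step_integral W n p c)) 1"
    unfolding char_def using m by (subst integral_distr) auto
  also have "\<dots> = (\<Prod>i<n. char (distr M borel (\<lambda>\<omega>. c i * (W (p (Suc i)) \<omega> - W (p i) \<omega>))) 1)"
    unfolding step_integral_def by (rule char_distr_sum[OF ind])
  also have "\<dots> = (\<Prod>i<n. complex_of_real (exp (- ((c i)\<^sup>2 * (p (Suc i) - p i)) / 2)))"
  proof (intro prod.cong refl)
    fix i assume i: "i \<in> {..<n}"
    have "char (distr M borel (\<lambda>\<omega>. c i * (W (p (Suc i)) \<omega> - W (p i) \<omega>))) 1
      = (\<integral>\<omega>. iexp (c i * (W (p (Suc i)) \<omega> - W (p i) \<omega>)) \<partial>M)"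
      unfolding char_def using i by (subst integral_distr) auto
    then show "char (distr M borel (\<lambda>\<omega>. c i * (W (p (Suc i)) \<omega> - W (p i) \<omega>))) 1 =
      complex_of_real (exp (- ((c i)\<^sup>2 * (p (Suc i) - p i)) / 2))"
      using char_increment[of "p i" "p (Suc i)" "c i"] pm[of i] i by simp
  qed
  also have "\<dots> = complex_of_real (exp (\<Sum>i<n. - ((c i)\<^sup>2 * (p (Suc i) - p i)) / 2))"
    by (simp add: exp_sum)
  also have "(\<Sum>i<n. - ((c i)\<^sup>2 * (p (Suc i) - p i)) / 2) = - (\<integral>s. (step_function n p c s)\<^sup>2 \<partial>lborel) / 2"
    using has_bochner_integral_integral_eq[OF step_function_square_integral[OF assms, of c]]
    by (simp add: sum_negf sum_divide_distrib)
  finally show ?thesis .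
qed

end

section \<open>Mean square convergence\<close>

lemma square_integrable_mult:
  assumes "square_integrable M f" "square_integrable M g"
  shows "integrable M (\<lambda>x. f x * g x)"
proof (rule Bochner_Integration.integrable_bound)
  show "integrable M (\<lambda>x. (f x)\<^sup>2 + (g x)\<^sup>2)"
    using assms by (auto simp: square_integrable_def)
  show "(\<lambda>x. f x * g x) \<in> borel_measurable M"
    using assms by (auto simp: square_integrable_def)
  have "\<bar>u * v\<bar> \<le> u\<^sup>2 + v\<^sup>2" for u v :: real
  proof -
    have "2 * (\<bar>u\<bar> * \<bar>v\<bar>) \<le> u\<^sup>2 + v\<^sup>2" "0 \<le> \<bar>u\<bar> * \<bar>v\<bar>"
      using sum_squares_bound[of "\<bar>u\<bar>" "\<bar>v\<bar>"] by auto
    then show ?thesis unfolding abs_mult by linarith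
  qed
  then show "AE x in M. norm (f x * g x) \<le> norm ((f x)\<^sup>2 + (g x)\<^sup>2)" by simp
qed

lemma square_integrable_linear:
  assumes "square_integrable M f" "square_integrable M g"
  shows "square_integrable M (\<lambda>x. a * f x + b * g x)"
proof -
  have "(\<lambda>x. (a * f x + b * g x)\<^sup>2) = (\<lambda>x. a\<^sup>2 * (f x)\<^sup>2 + (2 * a * b) * (f x * g x) + b\<^sup>2 * (g x)\<^sup>2)"
    by (auto simp: power2_eq_square algebra_simps)
  then show ?thesis
    using assms square_integrable_mult[OF assms] by (auto simp: square_integrable_def)
qed

lemma square_integrable_diff:
  assumes "square_integrable M f" "square_integrable M g"
  shows "square_integrable M (\<lambda>x. f x - g x)"
  using square_integrable_linear[OF assms, of 1 "-1"] by simp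

text \<open>The integral of \<open>(f - r g)^2\<close> is nonnegative for every real
  \<open>r\<close>; the minimising \<open>r\<close> gives the inequality unless \<open>g\<close>
  vanishes almost everywhere.\<close>

lemma integral_Cauchy_Schwarz:
  fixes f g :: "'b \<Rightarrow> real"
  assumes f: "square_integrable M f" and g: "square_integrable M g"
  shows "(\<integral>x. f x * g x \<partial>M)\<^sup>2 \<le> (\<integral>x. (f x)\<^sup>2 \<partial>M) * (\<integral>x. (g x)\<^sup>2 \<partial>M)"
proof (cases "(\<integral>x. (g x)\<^sup>2 \<partial>M) = 0")
  case True
  then have "AE x in M. (g x)\<^sup>2 = 0"
    using g integral_nonneg_eq_0_iff_AE[of M "\<lambda>x. (g x)\<^sup>2"] by (auto simp: square_integrable_def)
  then have "(\<integral>x. f x * g x \<partial>M) = (\<integral>x. 0 \<partial>M)"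
    using f g by (intro integral_cong_AE) (auto simp: square_integrable_def)
  then show ?thesis using True by simp
next
  case False
  define A B C where "A = (\<integral>x. (f x)\<^sup>2 \<partial>M)" and "B = (\<integral>x. f x * g x \<partial>M)" and "C = (\<integral>x. (g x)\<^sup>2 \<partial>M)"
  have C: "C > 0" using False by (simp add: C_def order_less_le)
  let ?r = "B / C"
  have "0 \<le> (\<integral>x. (1 * f x + (- ?r) * g x)\<^sup>2 \<partial>M)" by simp
  also have "\<dots> = (\<integral>x. (f x)\<^sup>2 + (- 2 * ?r) * (f x * g x) + ?r\<^sup>2 * (g x)\<^sup>2 \<partial>M)"
    by (intro Bochner_Integration.integral_cong) (auto simp: power2_eq_square algebra_simps)
  also have "\<dots> = A + (- 2 * ?r) * B + ?r\<^sup>2 * C"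
    unfolding A_def B_def C_def using f g square_integrable_mult[OF f g]
    by (subst Bochner_Integration.integral_add; (subst Bochner_Integration.integral_add)?)
       (auto simp: square_integrable_def simp del: mult_minus_left)
  also have "\<dots> = A - B\<^sup>2 / C"
    using C by (simp add: power2_eq_square field_simps)
  finally show ?thesis using C by (simp add: A_def B_def C_def field_simps)
qed

lemma L2_tendsto_linear:
  assumes f: "L2_tendsto M f f' F" and g: "L2_tendsto M g g' F"
  shows "L2_tendsto M (\<lambda>i x. a * f i x + b * g i x) (\<lambda>x. a * f' x + b * g' x) F"
  unfolding L2_tendsto_def
proof (intro conjI)
  have ev: "\<forall>\<^sub>F i in F. square_integrable M (f i) \<and> square_integrable M (g i)"
    using f g by (auto simp: L2_tendsto_def intro: eventually_conj)
  have f': "square_integrable M f'" and g': "square_integrable M g'"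
    using f g by (auto simp: L2_tendsto_def)
  show "\<forall>\<^sub>F i in F. square_integrable M (\<lambda>x. a * f i x + b * g i x)"
    using ev by eventually_elim (auto intro: square_integrable_linear)
  show "square_integrable M (\<lambda>x. a * f' x + b * g' x)"
    using f' g' by (rule square_integrable_linear)
  show "((\<lambda>i. \<integral>x. (a * f i x + b * g i x - (a * f' x + b * g' x))\<^sup>2 \<partial>M) \<longlongrightarrow> 0) F"
  proof (rule tendsto_sandwich[OF always_eventually])
    show "\<forall>i. 0 \<le> (\<integral>x. (a * f i x + b * g i x - (a * f' x + b * g' x))\<^sup>2 \<partial>M)" by simp
    show "((\<lambda>i. 0) \<longlongrightarrow> (0::real)) F" by simp
    have "((\<lambda>i. 2 * a\<^sup>2 * (\<integral>x. (f i x - f' x)\<^sup>2 \<partial>M) + 2 * b\<^sup>2 * (\<integral>x. (g i x - g' x)\<^sup>2 \<partial>M))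
      \<longlongrightarrow> 2 * a\<^sup>2 * 0 + 2 * b\<^sup>2 * 0) F"
      using f g by (intro tendsto_intros) (auto simp: L2_tendsto_def)
    then show "((\<lambda>i. 2 * a\<^sup>2 * (\<integral>x. (f i x - f' x)\<^sup>2 \<partial>M) + 2 * b\<^sup>2 * (\<integral>x. (g i x - g' x)\<^sup>2 \<partial>M)) \<longlongrightarrow> 0) F"
      by simp
    show "\<forall>\<^sub>F i in F. (\<integral>x. (a * f i x + b * g i x - (a * f' x + b * g' x))\<^sup>2 \<partial>M) \<le>
      2 * a\<^sup>2 * (\<integral>x. (f i x - f' x)\<^sup>2 \<partial>M) + 2 * b\<^sup>2 * (\<integral>x. (g i x - g' x)\<^sup>2 \<partial>M)"
      using ev
    proof eventually_elim
      case (elim i)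
      have d: "square_integrable M (\<lambda>x. f i x - f' x)" "square_integrable M (\<lambda>x. g i x - g' x)"
        using elim f' g' by (auto intro: square_integrable_diff)
      have "(\<integral>x. (a * f i x + b * g i x - (a * f' x + b * g' x))\<^sup>2 \<partial>M) =
        (\<integral>x. (a * (f i x - f' x) + b * (g i x - g' x))\<^sup>2 \<partial>M)"
        by (simp add: algebra_simps)
      also have "\<dots> \<le> (\<integral>x. 2 * a\<^sup>2 * (f i x - f' x)\<^sup>2 + 2 * b\<^sup>2 * (g i x - g' x)\<^sup>2 \<partial>M)"
      proof (rule integral_mono)
        show "integrable M (\<lambda>x. (a * (f i x - f' x) + b * (g i x - g' x))\<^sup>2)"
          using square_integrable_linear[OF d] by (simp add: square_integrable_def)
        show "integrable M (\<lambda>x. 2 * a\<^sup>2 * (f i x - f' x)\<^sup>2 + 2 * b\<^sup>2 * (g i x - g' x)\<^sup>2)"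
          using d by (auto simp: square_integrable_def)
        fix x
        \<comment> \<open>With \<open>u\<close> and \<open>v\<close> the two summands,
          \<open>(u - v)^2 >= 0\<close> amounts to
          \<open>(u + v)^2 <= 2 u^2 + 2 v^2\<close>.\<close>
        have "0 \<le> (a * (f i x - f' x) - b * (g i x - g' x))\<^sup>2" by simp
        then show "(a * (f i x - f' x) + b * (g i x - g' x))\<^sup>2 \<le>
            2 * a\<^sup>2 * (f i x - f' x)\<^sup>2 + 2 * b\<^sup>2 * (g i x - g' x)\<^sup>2"
          unfolding power2_sum power2_diff power_mult_distrib by argo
      qed
      also have "\<dots> = 2 * a\<^sup>2 * (\<integral>x. (f i x - f' x)\<^sup>2 \<partial>M) + 2 * b\<^sup>2 * (\<integral>x. (g i x - g' x)\<^sup>2 \<partial>M)"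
        using d by (subst Bochner_Integration.integral_add) (auto simp: square_integrable_def)
      finally show ?case .
    qed
  qed
qed

text \<open>Write \<open>f i\<close> as \<open>g\<close> plus an error: the cross term is controlled
  by Cauchy-Schwarz and tends to 0 together with the norm of the error.\<close>

lemma L2_tendsto_integral_square:
  assumes "L2_tendsto M f g F"
  shows "((\<lambda>i. \<integral>x. (f i x)\<^sup>2 \<partial>M) \<longlongrightarrow> (\<integral>x. (g x)\<^sup>2 \<partial>M)) F"
proof (rule Lim_transform2)
  let ?d = "\<lambda>i. \<integral>x. (f i x - g x)\<^sup>2 \<partial>M"
  have g: "square_integrable M g" and d: "(?d \<longlongrightarrow> 0) F"
    using assms by (auto simp: L2_tendsto_def)
  show "((\<lambda>i. \<integral>x. (g x)\<^sup>2 \<partial>M) \<longlongrightarrow> (\<integral>x. (g x)\<^sup>2 \<partial>M)) F" by simp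
  have "((\<lambda>i. 2 * sqrt (?d i * (\<integral>x. (g x)\<^sup>2 \<partial>M)) + ?d i) \<longlongrightarrow> 2 * sqrt (0 * (\<integral>x. (g x)\<^sup>2 \<partial>M)) + 0) F"
    by (intro tendsto_intros d)
  then have lim: "((\<lambda>i. 2 * sqrt (?d i * (\<integral>x. (g x)\<^sup>2 \<partial>M)) + ?d i) \<longlongrightarrow> 0) F" by simp
  show "((\<lambda>i. (\<integral>x. (g x)\<^sup>2 \<partial>M) - (\<integral>x. (f i x)\<^sup>2 \<partial>M)) \<longlongrightarrow> 0) F"
  proof (rule Lim_null_comparison[OF _ lim])
    have "\<forall>\<^sub>F i in F. square_integrable M (f i)" using assms by (auto simp: L2_tendsto_def)
    then show "\<forall>\<^sub>F i in F. norm ((\<integral>x. (g x)\<^sup>2 \<partial>M) - (\<integral>x. (f i x)\<^sup>2 \<partial>M)) \<le>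
      2 * sqrt (?d i * (\<integral>x. (g x)\<^sup>2 \<partial>M)) + ?d i"
    proof eventually_elim
      case (elim i)
      have sd: "square_integrable M (\<lambda>x. f i x - g x)" using elim g by (rule square_integrable_diff)
      have "(\<integral>x. (f i x)\<^sup>2 \<partial>M) = (\<integral>x. (g x)\<^sup>2 + 2 * ((f i x - g x) * g x) + (f i x - g x)\<^sup>2 \<partial>M)"
        by (intro Bochner_Integration.integral_cong) (auto simp: power2_eq_square algebra_simps)
      also have "\<dots> = (\<integral>x. (g x)\<^sup>2 \<partial>M) + 2 * (\<integral>x. (f i x - g x) * g x \<partial>M) + ?d i"
        using g sd square_integrable_mult[OF sd g]
        by (subst Bochner_Integration.integral_add; (subst Bochner_Integration.integral_add)?)
          (auto simp: square_integrable_def)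
      finally have eq: "(\<integral>x. (f i x)\<^sup>2 \<partial>M) = (\<integral>x. (g x)\<^sup>2 \<partial>M) + 2 * (\<integral>x. (f i x - g x) * g x \<partial>M) + ?d i" .
      have "\<bar>\<integral>x. (f i x - g x) * g x \<partial>M\<bar> \<le> sqrt (?d i * (\<integral>x. (g x)\<^sup>2 \<partial>M))"
        using integral_Cauchy_Schwarz[OF sd g] by (simp add: real_le_rsqrt)
      moreover have "?d i \<ge> 0" by simp
      ultimately show ?case unfolding eq real_norm_def by linarith
    qed
  qed
qed

text \<open>Factoring out the unimodular \<open>iexp y\<close> reduces the bound to an increment
  from 0.\<close>

lemma norm_iexp_diff: "norm (iexp x - iexp y) \<le> \<bar>x - y\<bar>"
proof -
  have "iexp x - iexp y = iexp y * (iexp (x - y) - 1)"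
    by (simp add: algebra_simps flip: exp_add)
  then have "norm (iexp x - iexp y) = norm (iexp (x - y) - 1)"
    by (simp add: norm_mult del: of_real_diff)
  also have "\<dots> \<le> \<bar>x - y\<bar>" using iexp_approx1[of "x - y" 0] by simp
  finally show ?thesis .
qed

context prob_space begin

lemma square_integrable_integrable:
  assumes "square_integrable M f"
  shows "integrable M f"
  using square_integrable_mult[OF assms, of "\<lambda>_. 1"] by (simp add: square_integrable_def)

text \<open>Cauchy-Schwarz against the constant 1, whose square has expectation 1.\<close>

lemma expectation_abs_le:
  assumes "square_integrable M f"
  shows "expectation (\<lambda>x. \<bar>f x\<bar>) \<le> sqrt (expectation (\<lambda>x. (f x)\<^sup>2))"
proof -
  have "square_integrable M (\<lambda>x. \<bar>f x\<bar>)" "square_integrable M (\<lambda>_. 1)"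
    using assms by (auto simp: square_integrable_def)
  from integral_Cauchy_Schwarz[OF this] show ?thesis
    by (auto simp: prob_space intro: real_le_rsqrt)
qed

text \<open>The map \<open>iexp\<close> is 1-Lipschitz, so the expectations differ by at most the
  mean absolute error, which the root mean square error dominates.\<close>

lemma L2_tendsto_char:
  assumes "L2_tendsto M f g F"
  shows "((\<lambda>i. expectation (\<lambda>x. iexp (f i x))) \<longlongrightarrow> expectation (\<lambda>x. iexp (g x))) F"
proof (rule Lim_transform2)
  let ?d = "\<lambda>i. expectation (\<lambda>x. (f i x - g x)\<^sup>2)"
  have g: "square_integrable M g" and d: "(?d \<longlongrightarrow> 0) F"
    using assms by (auto simp: L2_tendsto_def)
  have lim: "((\<lambda>i. sqrt (?d i)) \<longlongrightarrow> 0) F"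
    using tendsto_real_sqrt[OF d] by simp
  show "((\<lambda>i. expectation (\<lambda>x. iexp (g x))) \<longlongrightarrow> expectation (\<lambda>x. iexp (g x))) F" by simp
  show "((\<lambda>i. expectation (\<lambda>x. iexp (g x)) - expectation (\<lambda>x. iexp (f i x))) \<longlongrightarrow> 0) F"
  proof (rule Lim_null_comparison[OF _ lim])
    have "\<forall>\<^sub>F i in F. square_integrable M (f i)" using assms by (auto simp: L2_tendsto_def)
    then show "\<forall>\<^sub>F i in F. norm (expectation (\<lambda>x. iexp (g x)) - expectation (\<lambda>x. iexp (f i x))) \<le> sqrt (?d i)"
    proof eventually_elim
      case (elim i)
      have sd: "square_integrable M (\<lambda>x. f i x - g x)" using elim g by (rule square_integrable_diff)
      have i: "integrable M (\<lambda>x. iexp (f i x))" "integrable M (\<lambda>x. iexp (g x))"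
        using elim g by (auto intro!: integrable_iexp simp: square_integrable_def)
      have "norm (expectation (\<lambda>x. iexp (g x)) - expectation (\<lambda>x. iexp (f i x))) =
          norm (expectation (\<lambda>x. iexp (g x) - iexp (f i x)))"
        using i by simp
      also have "\<dots> \<le> expectation (\<lambda>x. norm (iexp (g x) - iexp (f i x)))"
        by (rule integral_norm_bound)
      also have "\<dots> \<le> expectation (\<lambda>x. \<bar>f i x - g x\<bar>)"
      proof (rule integral_mono)
        show "integrable M (\<lambda>x. norm (iexp (g x) - iexp (f i x)))"
          using i by (intro integrable_norm Bochner_Integration.integrable_diff)
        show "integrable M (\<lambda>x. \<bar>f i x - g x\<bar>)"
          using square_integrable_integrable[OF sd] by (rule integrable_abs)
        show "norm (iexp (g x) - iexp (f i x)) \<le> \<bar>f i x - g x\<bar>" for x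
          using norm_iexp_diff[of "g x" "f i x"] by (metis abs_minus_commute)
      qed
      also have "\<dots> \<le> sqrt (?d i)"
        by (rule expectation_abs_le[OF sd])
      finally show ?case .
    qed
  qed
qed

end

text \<open>Extension by 0 off \<open>S\<close> is an isometry. Integrands given on different
  intervals \<open>[0,s]\<close> and \<open>[0,t]\<close> can thus be added in one space over the
  whole line.\<close>

lemma L2_tendsto_restrict_space:
  assumes "S \<in> sets M" "L2_tendsto (restrict_space M S) f g F"
  shows "L2_tendsto M (\<lambda>i x. indicator S x * f i x) (\<lambda>x. indicator S x * g x) F"
proof -
  have S: "S \<inter> space M \<in> sets M" using assms by auto
  have sq: "(indicator S x * h x)\<^sup>2 = indicator S x *\<^sub>R (h x)\<^sup>2" for h :: "_ \<Rightarrow> real" and x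
    by (auto simp: indicator_def)
  have "square_integrable (restrict_space M S) h \<longleftrightarrow> square_integrable M (\<lambda>x. indicator S x * h x)" for h :: "_ \<Rightarrow> real"
    unfolding square_integrable_def sq
    using S by (simp add: integrable_restrict_space borel_measurable_restrict_space_iff
      mult.commute)
  moreover have "(\<integral>x. (indicator S x * f i x - indicator S x * g x)\<^sup>2 \<partial>M) =
      (\<integral>x. (f i x - g x)\<^sup>2 \<partial>restrict_space M S)" for i
    using sq[where h="\<lambda>x. f i x - g x"] S by (simp add: integral_restrict_space right_diff_distrib)
  ultimately show ?thesis using assms(2) by (simp add: L2_tendsto_def)
qed

text \<open>For the approximating step functions the combination is, after merging the two
  partitions, a single step integral, whose characteristic function is known; both sides then pass
  to the limit.\<close>

lemma (in wiener_process) char_wiener_integrals: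
  assumes I: "wiener_integral M W 0 s f I" and J: "wiener_integral M W 0 t g J"
    and st: "s \<le> 1" "t \<le> 1"
  shows "expectation (\<lambda>\<omega>. iexp (a * I \<omega> + b * J \<omega>)) =
    exp (- (\<integral>r. (a * (indicator {0..s} r * f r) + b * (indicator {0..t} r * g r))\<^sup>2 \<partial>lborel) / 2)"
proof -
  obtain n p c where p: "\<And>k. partition_points 0 s (n k) (p k)"
    and f: "L2_tendsto (restrict_space lborel {0..s}) (\<lambda>k. step_function (n k) (p k) (c k)) f sequentially"
    and I': "L2_tendsto M (\<lambda>k. step_integral W (n k) (p k) (c k)) I sequentially"
    using I unfolding wiener_integral_def by auto
  obtain m q d where q: "\<And>k. partition_points 0 t (m k) (q k)"
    and g: "L2_tendsto (restrict_space lborel {0..t}) (\<lambda>k. step_function (m k) (q k) (d k)) g sequentially"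
    and J': "L2_tendsto M (\<lambda>k. step_integral W (m k) (q k) (d k)) J sequentially"
    using J unfolding wiener_integral_def by auto
  let ?Z = "\<lambda>k \<omega>. a * step_integral W (n k) (p k) (c k) \<omega> + b * step_integral W (m k) (q k) (d k) \<omega>"
  let ?F = "\<lambda>k r. a * step_function (n k) (p k) (c k) r + b * step_function (m k) (q k) (d k) r"
  have "L2_tendsto lborel (\<lambda>k r. a * (indicator {0..s} r * step_function (n k) (p k) (c k) r)
      + b * (indicator {0..t} r * step_function (m k) (q k) (d k) r))
    (\<lambda>r. a * (indicator {0..s} r * f r) + b * (indicator {0..t} r * g r)) sequentially"
    using f g by (intro L2_tendsto_linear L2_tendsto_restrict_space) auto
  moreover have "indicator {0..s} r * step_function (n k) (p k) (c k) r = step_function (n k) (p k) (c k) r"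
    "indicator {0..t} r * step_function (m k) (q k) (d k) r = step_function (m k) (q k) (d k) r" for r k
    using step_function_outside[OF p, of r k] step_function_outside[OF q, of r k]
    by (cases "r \<in> {0..s}"; cases "r \<in> {0..t}"; simp)+
  ultimately have F: "L2_tendsto lborel ?F
      (\<lambda>r. a * (indicator {0..s} r * f r) + b * (indicator {0..t} r * g r)) sequentially"
    by simp
  have char: "expectation (\<lambda>\<omega>. iexp (?Z k \<omega>)) = exp (- (\<integral>r. (?F k r)\<^sup>2 \<partial>lborel) / 2)" for k
  proof -
    have p1: "partition_points 0 1 (n k) (p k)" and q1: "partition_points 0 1 (m k) (q k)"
      using st by (auto intro: partition_points_subset[OF p] partition_points_subset[OF q])
    obtain N r e h where r: "partition_points 0 1 N r"
      and e: "\<And>V :: real \<Rightarrow> real. (\<Sum>i<n k. c k i * (V (p k (Suc i)) - V (p k i))) = (\<Sum>j<N. e j * (V (r (Suc j)) - V (r j)))"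
      and h: "\<And>V :: real \<Rightarrow> real. (\<Sum>i<m k. d k i * (V (q k (Suc i)) - V (q k i))) = (\<Sum>j<N. h j * (V (r (Suc j)) - V (r j)))"
      using merge_partitions[OF p1 q1, of "c k" "d k"] by blast
    \<comment> \<open>The merged coefficients are applied twice: here with \<open>V\<close> a path
      of \<open>W\<close>, and for \<open>?F k\<close> with \<open>V\<close> the indicator of the
      half-line from \<open>x\<close>.\<close>
    have "?Z k = step_integral W N r (\<lambda>j. a * e j + b * h j)"
      unfolding step_integral_def
    proof
      fix \<omega>
      show "a * (\<Sum>i<n k. c k i * (W (p k (Suc i)) \<omega> - W (p k i) \<omega>)) + b * (\<Sum>i<m k. d k i * (W (q k (Suc i)) \<omega> - W (q k i) \<omega>))
        = (\<Sum>i<N. (a * e i + b * h i) * (W (r (Suc i)) \<omega> - W (r i) \<omega>))"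
        using e[of "\<lambda>u. W u \<omega>"] h[of "\<lambda>u. W u \<omega>"]
        by (simp add: sum_distrib_left sum.distrib distrib_right mult.assoc)
    qed
    moreover have "?F k = step_function N r (\<lambda>j. a * e j + b * h j)"
    proof
      fix x
      show "?F k x = step_function N r (\<lambda>j. a * e j + b * h j) x"
        unfolding step_function_eq_increments[OF p1] step_function_eq_increments[OF q1]
          step_function_eq_increments[OF r] e[of "\<lambda>u. indicator {x..} u"] h[of "\<lambda>u. indicator {x..} u"]
        by (simp add: sum_distrib_left sum.distrib distrib_right mult.assoc)
    qed
    ultimately show ?thesis
      using char_step_integral[OF r, of "\<lambda>j. a * e j + b * h j"] by (simp only: fun_eq_iff)
  qed
  have "(\<lambda>k. complex_of_real (exp (- (\<integral>r. (?F k r)\<^sup>2 \<partial>lborel) / 2))) \<longlonglongrightarrow>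
    exp (- (\<integral>r. (a * (indicator {0..s} r * f r) + b * (indicator {0..t} r * g r))\<^sup>2 \<partial>lborel) / 2)"
    using L2_tendsto_integral_square[OF F] by (intro tendsto_intros) simp_all
  moreover have "(\<lambda>k. expectation (\<lambda>\<omega>. iexp (?Z k \<omega>))) \<longlonglongrightarrow> expectation (\<lambda>\<omega>. iexp (a * I \<omega> + b * J \<omega>))"
    by (intro L2_tendsto_char L2_tendsto_linear I' J')
  ultimately show ?thesis
    unfolding char by (rule LIMSEQ_unique[rotated])
qed

section \<open>Mean square limits from a Cauchy estimate with a rate\<close>

context prob_space begin

text \<open>The mean absolute increments are at most \<open>sqrt C * (1/2) ^ k\<close>, hence
  summable. So the sum of the absolute increments has finite expectation and is finite almost
  surely; wherever it is finite, the telescoping series converges.\<close>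

lemma L2_summable_increments_AE_limit:
  assumes sq: "\<And>k. square_integrable M (f k)"
    and incr: "\<And>k. expectation (\<lambda>\<omega>. (f (Suc k) \<omega> - f k \<omega>)\<^sup>2) \<le> C * (1/4) ^ k"
  obtains L where "L \<in> borel_measurable M" "AE \<omega> in M. (\<lambda>k. f k \<omega>) \<longlonglongrightarrow> L \<omega>"
proof
  have [measurable]: "f k \<in> borel_measurable M" for k using sq by (simp add: square_integrable_def)
  \<comment> \<open>\<open>lim\<close> is total, so this witness is defined and measurable even
    where the sequence diverges.\<close>
  show "(\<lambda>\<omega>. lim (\<lambda>k. f k \<omega>)) \<in> borel_measurable M" by measurable
  let ?d = "\<lambda>k \<omega>. \<bar>f (Suc k) \<omega> - f k \<omega>\<bar>"
  have "(\<integral>\<^sup>+\<omega>. ennreal (?d k \<omega>) \<partial>M) \<le> ennreal (sqrt C * (1/2) ^ k)" for k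
  proof -
    have sd: "square_integrable M (\<lambda>\<omega>. f (Suc k) \<omega> - f k \<omega>)" using sq by (intro square_integrable_diff)
    have "(\<integral>\<^sup>+\<omega>. ennreal (?d k \<omega>) \<partial>M) = ennreal (expectation (?d k))"
      using square_integrable_integrable[OF sd] by (intro nn_integral_eq_integral) auto
    also have "expectation (?d k) \<le> sqrt (C * (1/4) ^ k)"
      using expectation_abs_le[OF sd] incr[of k] by (meson order_trans real_sqrt_le_iff)
    also have "\<dots> = sqrt C * (1/2) ^ k"
      by (simp add: real_sqrt_mult real_sqrt_power real_sqrt_divide)
    finally show ?thesis by (simp add: ennreal_leI)
  qed
  then have "(\<Sum>k. \<integral>\<^sup>+\<omega>. ennreal (?d k \<omega>) \<partial>M) \<le> (\<Sum>k. ennreal (sqrt C * (1/2) ^ k))"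
    by (intro suminf_le) auto
  moreover have "(\<Sum>k. ennreal (sqrt C * (1/2) ^ k)) < \<infinity>"
  proof -
    \<comment> \<open>The increment bound at \<open>k = 0\<close> forces \<open>C\<close> to be
      nonnegative.\<close>
    have "0 \<le> expectation (\<lambda>\<omega>. (f (Suc 0) \<omega> - f 0 \<omega>)\<^sup>2)" by simp
    also have "\<dots> \<le> C" using incr[of 0] by simp
    finally have "0 \<le> C" .
    then have "(\<Sum>k. ennreal (sqrt C * (1/2) ^ k)) = ennreal (\<Sum>k. sqrt C * (1/2) ^ k)"
      by (intro suminf_ennreal2 summable_mult summable_geometric) auto
    then show ?thesis by simp
  qed
  ultimately have "(\<integral>\<^sup>+\<omega>. (\<Sum>k. ennreal (?d k \<omega>)) \<partial>M) \<noteq> \<infinity>"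
    by (subst nn_integral_suminf) (auto simp: top_unique less_top)
  then have "AE \<omega> in M. (\<Sum>k. ennreal (?d k \<omega>)) \<noteq> \<infinity>"
    by (intro nn_integral_PInf_AE) auto
  then show "AE \<omega> in M. (\<lambda>k. f k \<omega>) \<longlonglongrightarrow> lim (\<lambda>k. f k \<omega>)"
  proof eventually_elim
    case (elim \<omega>)
    then have "summable (\<lambda>k. f (Suc k) \<omega> - f k \<omega>)"
      by (intro summable_rabs_cancel[OF summable_suminf_not_top]) auto
    then have "convergent (\<lambda>n. (f n \<omega> - f 0 \<omega>) + f 0 \<omega>)"
      using sum_lessThan_telescope[of "\<lambda>k. f k \<omega>"]
      by (intro convergent_add) (auto simp: summable_iff_convergent convergent_const)
    then show ?case by (simp add: convergent_LIMSEQ_iff)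
  qed
qed

text \<open>Fatou's lemma for \<open>(g - f k)^2\<close> carries the bound to the almost sure limit,
  and \<open>L = g - (g - L)\<close> inherits square integrability.\<close>

lemma L2_Fatou:
  assumes sq: "\<And>k. square_integrable M (f k)" and g: "square_integrable M g"
    and L[measurable]: "L \<in> borel_measurable M" and lim: "AE \<omega> in M. (\<lambda>k. f k \<omega>) \<longlonglongrightarrow> L \<omega>"
    and b: "\<forall>\<^sub>F k in sequentially. expectation (\<lambda>\<omega>. (g \<omega> - f k \<omega>)\<^sup>2) \<le> b"
  shows "square_integrable M L" "expectation (\<lambda>\<omega>. (g \<omega> - L \<omega>)\<^sup>2) \<le> b"
proof -
  have [measurable]: "f k \<in> borel_measurable M" "g \<in> borel_measurable M" for k
    using sq g by (auto simp: square_integrable_def)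
  have int: "(\<integral>\<^sup>+\<omega>. ennreal ((g \<omega> - f k \<omega>)\<^sup>2) \<partial>M) = ennreal (expectation (\<lambda>\<omega>. (g \<omega> - f k \<omega>)\<^sup>2))" for k
    using square_integrable_diff[OF g sq[of k]] by (intro nn_integral_eq_integral) (auto simp: square_integrable_def)
  obtain k where "expectation (\<lambda>\<omega>. (g \<omega> - f k \<omega>)\<^sup>2) \<le> b"
    using b by (auto simp: eventually_sequentially)
  then have b0: "0 \<le> b" by (rule order_trans[rotated]) simp
  have "(\<integral>\<^sup>+\<omega>. ennreal ((g \<omega> - L \<omega>)\<^sup>2) \<partial>M) = (\<integral>\<^sup>+\<omega>. liminf (\<lambda>k. ennreal ((g \<omega> - f k \<omega>)\<^sup>2)) \<partial>M)"
    using lim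
  proof (intro nn_integral_cong_AE, eventually_elim)
    case (elim \<omega>)
    then have "(\<lambda>k. ennreal ((g \<omega> - f k \<omega>)\<^sup>2)) \<longlonglongrightarrow> ennreal ((g \<omega> - L \<omega>)\<^sup>2)"
      by (intro tendsto_intros)
    then show ?case by (rule lim_imp_Liminf[symmetric, OF sequentially_bot])
  qed
  also have "\<dots> \<le> liminf (\<lambda>k. \<integral>\<^sup>+\<omega>. ennreal ((g \<omega> - f k \<omega>)\<^sup>2) \<partial>M)"
    by (intro nn_integral_liminf) measurable
  also have "\<dots> \<le> liminf (\<lambda>k. ennreal b)"
    unfolding int by (intro Liminf_mono eventually_mono[OF b]) (rule ennreal_leI)
  also have "\<dots> = ennreal b" by (simp add: Liminf_const)
  finally have le: "(\<integral>\<^sup>+\<omega>. ennreal ((g \<omega> - L \<omega>)\<^sup>2) \<partial>M) \<le> ennreal b" .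
  then have fin: "(\<integral>\<^sup>+\<omega>. ennreal ((g \<omega> - L \<omega>)\<^sup>2) \<partial>M) < \<infinity>"
    by (auto intro: le_less_trans)
  then have "integrable M (\<lambda>\<omega>. (g \<omega> - L \<omega>)\<^sup>2)"
    by (intro integrableI_bounded) auto
  then have sd: "square_integrable M (\<lambda>\<omega>. g \<omega> - L \<omega>)" by (simp add: square_integrable_def)
  show "square_integrable M L" using square_integrable_diff[OF g sd] by simp
  show "expectation (\<lambda>\<omega>. (g \<omega> - L \<omega>)\<^sup>2) \<le> b"
    using le b0 sd nn_integral_eq_integral[of M "\<lambda>\<omega>. (g \<omega> - L \<omega>)\<^sup>2"] by (simp add: square_integrable_def)
qed

text \<open>A limit is found along a sequence tending to 0 fast enough for almost sure convergence.
  Comparing an arbitrary \<open>\<epsilon>\<close> with later members of the sequence, Fatou's lemma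
  gives the rate \<open>C * \<epsilon> powr p\<close> for the whole family.\<close>

lemma L2_limit_at_right_0:
  fixes f :: "real \<Rightarrow> 'a \<Rightarrow> real"
  assumes sq: "\<And>\<epsilon>. \<epsilon> > 0 \<Longrightarrow> square_integrable M (f \<epsilon>)" and "p > 0"
    and incr: "\<And>\<epsilon> \<delta>. 0 < \<epsilon> \<Longrightarrow> \<epsilon> \<le> \<delta> \<Longrightarrow> expectation (\<lambda>\<omega>. (f \<delta> \<omega> - f \<epsilon> \<omega>)\<^sup>2) \<le> C * \<delta> powr p"
  shows "\<exists>L. L2_tendsto M f L (at_right 0)"
proof -
  \<comment> \<open>The sequence is tuned so that \<open>e k powr p = (1/4) ^ k\<close>, the decay
    required for the almost sure limit.\<close>
  define e where "e k = (1/4) powr (real k / p)" for k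
  have e_pos: "e k > 0" for k by (simp add: e_def)
  have e_powr: "e k powr p = (1/4) ^ k" for k
    using \<open>p > 0\<close> by (simp add: e_def powr_powr powr_realpow)
  have e_antimono: "e l \<le> e k" if "k \<le> l" for k l
    using that \<open>p > 0\<close> by (auto simp: e_def divide_right_mono intro!: powr_mono')
  have e_lim: "e \<longlonglongrightarrow> 0"
  proof -
    have "e = (\<lambda>k. ((1/4) powr (1 / p)) ^ k)"
      by (auto simp: e_def powr_powr simp flip: powr_realpow)
    moreover have "(1/4) powr (1 / p) < (1::real)" using \<open>p > 0\<close> powr_less_mono'[of "1/4" 0 "1/p"] by simp
    ultimately show ?thesis by (simp add: LIMSEQ_realpow_zero)
  qed
  have step: "expectation (\<lambda>\<omega>. (f (e (Suc k)) \<omega> - f (e k) \<omega>)\<^sup>2) \<le> C * (1/4) ^ k" for k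
    using incr[of "e (Suc k)" "e k"] e_pos e_antimono[of k "Suc k"] by (simp add: e_powr power2_commute)
  obtain L where L: "L \<in> borel_measurable M" "AE \<omega> in M. (\<lambda>k. f (e k) \<omega>) \<longlonglongrightarrow> L \<omega>"
    using L2_summable_increments_AE_limit[of "\<lambda>k. f (e k)", OF sq[OF e_pos] step] .
  have bd: "square_integrable M L \<and> expectation (\<lambda>\<omega>. (f \<epsilon> \<omega> - L \<omega>)\<^sup>2) \<le> C * \<epsilon> powr p" if "\<epsilon> > 0" for \<epsilon>
  proof -
    have "\<forall>\<^sub>F k in sequentially. e k < \<epsilon>"
      using e_lim that by (rule order_tendstoD)
    then have "\<forall>\<^sub>F k in sequentially. expectation (\<lambda>\<omega>. (f \<epsilon> \<omega> - f (e k) \<omega>)\<^sup>2) \<le> C * \<epsilon> powr p"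
      by eventually_elim (use incr e_pos in auto)
    from L2_Fatou[of "\<lambda>k. f (e k)", OF sq[OF e_pos] sq[OF that] L this] show ?thesis by simp
  qed
  have "L2_tendsto M f L (at_right 0)"
    unfolding L2_tendsto_def
  proof (intro conjI)
    have pos: "\<forall>\<^sub>F \<epsilon> :: real in at_right 0. 0 < \<epsilon>" by (simp add: eventually_at_right_less)
    show "\<forall>\<^sub>F \<epsilon> in at_right 0. square_integrable M (f \<epsilon>)"
      using pos by eventually_elim (rule sq)
    show "square_integrable M L" using bd[of 1] by simp
    show "((\<lambda>\<epsilon>. expectation (\<lambda>\<omega>. (f \<epsilon> \<omega> - L \<omega>)\<^sup>2)) \<longlongrightarrow> 0) (at_right 0)"
    proof (rule tendsto_sandwich[where f="\<lambda>_. 0"])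
      show "\<forall>\<^sub>F \<epsilon> in at_right 0. expectation (\<lambda>\<omega>. (f \<epsilon> \<omega> - L \<omega>)\<^sup>2) \<le> C * \<epsilon> powr p"
        using pos by eventually_elim (use bd in auto)
      have "((\<lambda>\<epsilon>::real. \<epsilon> powr p) \<longlongrightarrow> 0) (at_right 0)"
        using pos \<open>p > 0\<close> by (intro tendsto_zero_powrI[where b=p]) (auto elim: eventually_mono)
      then show "((\<lambda>\<epsilon>. C * \<epsilon> powr p) \<longlongrightarrow> 0) (at_right 0)" by (intro tendsto_mult_right_zero)
    qed auto
  qed
  then show ?thesis by (intro exI)
qed

end

text \<open>Complete the square in \<open>y\<close>. The form has coefficients \<open>A\<close> at
  \<open>y^2\<close>, \<open>B\<close> at \<open>2 x y\<close> and \<open>D = G + V\<close> at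
  \<open>x^2\<close>, where \<open>G\<close> and \<open>V\<close> are the parts of \<open>D\<close>
  over \<open>[0,s]\<close> and \<open>(s,t]\<close>. As \<open>B\<close> only sees
  \<open>[0,s]\<close>, Cauchy-Schwarz there gives \<open>B^2 <= A G\<close>; with
  \<open>\<beta> = B / A\<close> at least \<open>A (y + \<beta> x)^2 + V x^2\<close> remains, and
  \<open>A\<close>, \<open>V\<close> are bounded below through \<open>m\<close>.\<close>

lemma quadratic_form_lower_bound:
  fixes f g :: "real \<Rightarrow> real"
  assumes st: "0 < s" "s < t" and m: "m > 0"
    and f: "square_integrable lborel (\<lambda>r. indicator {0..s} r * f r)" (is "square_integrable _ ?f")
    and g: "square_integrable lborel (\<lambda>r. indicator {0..t} r * g r)" (is "square_integrable _ ?g")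
    and mf: "\<And>r. r \<in> {0..s} \<Longrightarrow> m \<le> \<bar>f r\<bar>" and mg: "\<And>r. r \<in> {0..t} \<Longrightarrow> m \<le> \<bar>g r\<bar>"
  shows "\<exists>\<beta>. \<forall>x y. m\<^sup>2 * s * (y + \<beta> * x)\<^sup>2 + m\<^sup>2 * (t - s) * x\<^sup>2 \<le>
    (\<integral>r. (x * (indicator {0..t} r * g r) + y * (indicator {0..s} r * f r))\<^sup>2 \<partial>lborel)"
proof -
  let ?g1 = "\<lambda>r. indicator {0..s} r * ?g r" and ?g2 = "\<lambda>r. indicator {s<..t} r * ?g r"
  have restr: "square_integrable lborel (\<lambda>r. indicator S r * ?g r)" if [measurable]: "S \<in> sets borel" for S
  proof -
    have [measurable]: "?g \<in> borel_measurable lborel" and i: "integrable lborel (\<lambda>r. (?g r)\<^sup>2)"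
      using g by (auto simp: square_integrable_def)
    have "integrable lborel (\<lambda>r. (indicator S r * ?g r)\<^sup>2)"
      by (rule Bochner_Integration.integrable_bound[OF i]) (measurable, auto simp: indicator_def)
    then show ?thesis by (simp add: square_integrable_def)
  qed
  have g1: "square_integrable lborel ?g1" and g2: "square_integrable lborel ?g2"
    by (auto intro!: restr simp del: indicator_simps)
  define A B D G V where "A = (\<integral>r. (?f r)\<^sup>2 \<partial>lborel)" and "B = (\<integral>r. ?f r * ?g r \<partial>lborel)"
    and "D = (\<integral>r. (?g r)\<^sup>2 \<partial>lborel)" and "G = (\<integral>r. (?g1 r)\<^sup>2 \<partial>lborel)" and "V = (\<integral>r. (?g2 r)\<^sup>2 \<partial>lborel)"
  have lower: "m\<^sup>2 * (b - a) \<le> (\<integral>r. (h r)\<^sup>2 \<partial>lborel)"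
    if h: "square_integrable lborel h" and ab: "a \<le> b" and mh: "\<And>r. r \<in> {a<..b} \<Longrightarrow> m \<le> \<bar>h r\<bar>" for h :: "real \<Rightarrow> real" and a b
  proof -
    have "m\<^sup>2 * (b - a) = (\<integral>r. m\<^sup>2 * indicator {a<..b} r \<partial>lborel)" using ab by simp
    also have "\<dots> \<le> (\<integral>r. (h r)\<^sup>2 \<partial>lborel)"
    proof (rule integral_mono)
      show "integrable lborel (\<lambda>r. m\<^sup>2 * indicator {a<..b} r)" using ab by simp
      show "integrable lborel (\<lambda>r. (h r)\<^sup>2)" using h by (simp add: square_integrable_def)
      show "m\<^sup>2 * indicator {a<..b} r \<le> (h r)\<^sup>2" for r
        using m mh[of r] power_mono[of m "\<bar>h r\<bar>" 2] by (auto simp: indicator_def)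
    qed
    finally show ?thesis .
  qed
  have A: "m\<^sup>2 * s \<le> A"
    unfolding A_def using lower[OF f, of 0 s] st mf by (auto simp: indicator_def)
  have V: "m\<^sup>2 * (t - s) \<le> V"
    unfolding V_def using lower[OF g2, of s t] st mg by (auto simp: indicator_def)
  have Apos: "A > 0" using A m st by (smt (verit) mult_pos_pos zero_less_power)
  have "D = (\<integral>r. (?g1 r)\<^sup>2 + (?g2 r)\<^sup>2 \<partial>lborel)"
    unfolding D_def using st by (intro Bochner_Integration.integral_cong) (auto simp: indicator_def)
  also have "\<dots> = G + V"
    unfolding G_def V_def using g1 g2 by (intro Bochner_Integration.integral_add) (auto simp: square_integrable_def)
  finally have D: "D = G + V" .
  have "B = (\<integral>r. ?f r * ?g1 r \<partial>lborel)"
    unfolding B_def by (intro Bochner_Integration.integral_cong) (auto simp: indicator_def)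
  then have B: "B\<^sup>2 \<le> A * G"
    unfolding A_def G_def using integral_Cauchy_Schwarz[OF f g1] by simp
  show ?thesis
  proof (intro exI[of _ "B / A"] allI)
    fix x y :: real
    have "(\<integral>r. (x * ?g r + y * ?f r)\<^sup>2 \<partial>lborel) = (\<integral>r. y\<^sup>2 * (?f r)\<^sup>2 + 2 * x * y * (?f r * ?g r) + x\<^sup>2 * (?g r)\<^sup>2 \<partial>lborel)"
      by (intro Bochner_Integration.integral_cong) (auto simp: power2_eq_square algebra_simps)
    also have "\<dots> = y\<^sup>2 * A + 2 * x * y * B + x\<^sup>2 * D"
      unfolding A_def B_def D_def using f g square_integrable_mult[OF f g]
      by (subst Bochner_Integration.integral_add; (subst Bochner_Integration.integral_add)?)
        (simp_all add: square_integrable_def)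
    also have "\<dots> = A * (y + B / A * x)\<^sup>2 + (G - B\<^sup>2 / A) * x\<^sup>2 + V * x\<^sup>2"
      unfolding D using Apos by (simp add: power2_eq_square field_simps)
    \<comment> \<open>The fact \<open>B\<close> makes the middle term nonnegative; the facts
      \<open>A\<close> and \<open>V\<close> bound the outer two.\<close>
    also have "\<dots> \<ge> m\<^sup>2 * s * (y + B / A * x)\<^sup>2 + 0 + m\<^sup>2 * (t - s) * x\<^sup>2"
      using A V B Apos by (intro add_mono mult_right_mono mult_nonneg_nonneg) (auto simp: field_simps)
    finally show "m\<^sup>2 * s * (y + B / A * x)\<^sup>2 + m\<^sup>2 * (t - s) * x\<^sup>2 \<le> (\<integral>r. (x * ?g r + y * ?f r)\<^sup>2 \<partial>lborel)"
      by simp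
  qed
qed

section \<open>Fourier representation of second moments\<close>

text \<open>The product is dominated by \<open>C\<close> times the norm of \<open>\<phi>\<close>,
  which is integrable over the product space because \<open>M\<close> is finite. A weight on a
  sigma-finite space covers both uses: frequency integrals weighted by a Fourier symbol, and time
  integrals with weight 1.\<close>

lemma Fubini_integral_weighted:
  fixes \<phi> :: "'b \<Rightarrow> 'c::{real_normed_field, banach, second_countable_topology}"
  assumes "finite_measure M" "sigma_finite_measure N" and \<phi>: "integrable N \<phi>"
    and [measurable]: "(\<lambda>(x, \<omega>). F x \<omega>) \<in> borel_measurable (N \<Otimes>\<^sub>M M)"
    and C: "\<And>x \<omega>. x \<in> space N \<Longrightarrow> \<omega> \<in> space M \<Longrightarrow> norm (F x \<omega>) \<le> C"
  shows "(\<integral>\<omega>. \<integral>x. \<phi> x * F x \<omega> \<partial>N \<partial>M) = (\<integral>x. \<phi> x * (\<integral>\<omega>. F x \<omega> \<partial>M) \<partial>N)"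
proof -
  interpret M: finite_measure M by fact
  interpret N: sigma_finite_measure N by fact
  interpret pair_sigma_finite N M by unfold_locales
  have [measurable]: "\<phi> \<in> borel_measurable N" using \<phi> by auto
  have F: "integrable M (F x)" if "x \<in> space N" for x
    using that C by (intro M.integrable_const_bound[where B=C]) auto
  have "integrable (N \<Otimes>\<^sub>M M) (\<lambda>p. norm (\<phi> (fst p)))"
  proof (rule Fubini_integrable)
    show "integrable N (\<lambda>x. \<integral>y. norm (norm (\<phi> (fst (x, y)))) \<partial>M)"
      using \<phi> by (auto intro!: integrable_mult_right integrable_norm)
  qed auto
  then have "integrable (N \<Otimes>\<^sub>M M) (\<lambda>p. C * norm (\<phi> (fst p)))" by simp
  then have "integrable (N \<Otimes>\<^sub>M M) (\<lambda>(x, \<omega>). \<phi> x * F x \<omega>)"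
  proof (rule Bochner_Integration.integrable_bound)
    show "AE p in N \<Otimes>\<^sub>M M. norm ((\<lambda>(x, \<omega>). \<phi> x * F x \<omega>) p) \<le> norm (C * norm (\<phi> (fst p)))"
    proof (rule AE_I2)
      fix p assume p: "p \<in> space (N \<Otimes>\<^sub>M M)"
      then have "norm (F (fst p) (snd p)) \<le> \<bar>C\<bar>" using C[of "fst p" "snd p"] by (auto simp: space_pair_measure)
      then have "norm (\<phi> (fst p)) * norm (F (fst p) (snd p)) \<le> norm (\<phi> (fst p)) * \<bar>C\<bar>"
        by (intro mult_left_mono) auto
      then show "norm ((\<lambda>(x, \<omega>). \<phi> x * F x \<omega>) p) \<le> norm (C * norm (\<phi> (fst p)))"
        by (simp add: split_beta norm_mult abs_mult mult.commute)
    qed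
  qed measurable
  from Fubini_integral[OF this]
  have "(\<integral>\<omega>. \<integral>x. \<phi> x * F x \<omega> \<partial>N \<partial>M) = (\<integral>x. \<integral>\<omega>. \<phi> x * F x \<omega> \<partial>M \<partial>N)" .
  also have "\<dots> = (\<integral>x. \<phi> x * (\<integral>\<omega>. F x \<omega> \<partial>M) \<partial>N)"
    using F by (intro Bochner_Integration.integral_cong refl Bochner_Integration.integral_mult_right) auto
  finally show ?thesis .
qed

text \<open>If \<open>f\<close> is not integrable, its Bochner integral is 0 and the bound is
  trivial.\<close>

lemma norm_integral_le_nn_integral:
  fixes f :: "'b \<Rightarrow> 'c::{banach, second_countable_topology}"
  shows "ennreal (norm (integral\<^sup>L M f)) \<le> (\<integral>\<^sup>+x. norm (f x) \<partial>M)"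
  by (cases "integrable M f") (auto simp: integral_norm_bound_ennreal not_integrable_integral_eq)

text \<open>The square of an integral over \<open>N\<close> is a double integral, and two exchanges
  bring the integral over \<open>M\<close> inside. Absolute values then give a nonnegative double
  integral of correlations, which can be estimated pointwise.\<close>

lemma second_moment_integral_le:
  fixes g :: "'b \<Rightarrow> 'a \<Rightarrow> real"
  assumes M: "finite_measure M" and N: "finite_measure N"
    and g[measurable]: "(\<lambda>(x, \<omega>). g x \<omega>) \<in> borel_measurable (N \<Otimes>\<^sub>M M)"
    and C: "\<And>x \<omega>. x \<in> space N \<Longrightarrow> \<omega> \<in> space M \<Longrightarrow> \<bar>g x \<omega>\<bar> \<le> C"
  shows "ennreal (\<integral>\<omega>. (\<integral>x. g x \<omega> \<partial>N)\<^sup>2 \<partial>M) \<le>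
    (\<integral>\<^sup>+x. \<integral>\<^sup>+y. ennreal \<bar>\<integral>\<omega>. g x \<omega> * g y \<omega> \<partial>M\<bar> \<partial>N \<partial>N)"
proof -
  interpret M: finite_measure M by fact
  interpret N: finite_measure N by fact
  let ?G = "\<lambda>\<omega>. \<integral>y. g y \<omega> \<partial>N"
  have [measurable]: "(\<lambda>(\<omega>, x). g x \<omega>) \<in> borel_measurable (M \<Otimes>\<^sub>M N)"
    using measurable_compose[OF measurable_pair_swap' g] by (simp add: split_beta)
  have [measurable]: "?G \<in> borel_measurable M" by measurable
  have G: "\<bar>?G \<omega>\<bar> \<le> C * measure N (space N)" if "\<omega> \<in> space M" for \<omega>
  proof -
    have i: "integrable N (\<lambda>y. g y \<omega>)"
      using that C by (intro N.integrable_const_bound[where B=C]) auto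
    have "\<bar>?G \<omega>\<bar> \<le> (\<integral>y. \<bar>g y \<omega>\<bar> \<partial>N)" by (rule integral_abs_bound)
    also have "\<dots> \<le> (\<integral>y. C \<partial>N)" using i that C by (intro integral_mono) auto
    finally show ?thesis by (simp add: mult.commute)
  qed
  have gg: "\<bar>g x \<omega> * u\<bar> \<le> C * D" if "x \<in> space N" "\<omega> \<in> space M" "\<bar>u\<bar> \<le> D" for x \<omega> u D
    using that C[OF that(1,2)] unfolding abs_mult by (intro mult_mono) auto
  \<comment> \<open>The factor 1 is the weight in \<open>Fubini_integral_weighted\<close>.\<close>
  have "(\<integral>\<omega>. (?G \<omega>)\<^sup>2 \<partial>M) = (\<integral>\<omega>. (\<integral>x. 1 * (g x \<omega> * ?G \<omega>) \<partial>N) \<partial>M)"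
    by (simp add: power2_eq_square)
  also have "\<dots> = (\<integral>x. 1 * (\<integral>\<omega>. g x \<omega> * ?G \<omega> \<partial>M) \<partial>N)"
    using gg G by (intro Fubini_integral_weighted[where C="C * (C * measure N (space N))"] M) (auto intro: N.sigma_finite_measure_axioms)
  also have "\<dots> = (\<integral>x. (\<integral>\<omega>. \<integral>y. 1 * (g x \<omega> * g y \<omega>) \<partial>N \<partial>M) \<partial>N)"
    by simp
  also have "\<dots> = (\<integral>x. (\<integral>y. 1 * (\<integral>\<omega>. g x \<omega> * g y \<omega> \<partial>M) \<partial>N) \<partial>N)"
    using gg C by (intro Bochner_Integration.integral_cong refl Fubini_integral_weighted[where C="C * C"] M)
     (auto intro: N.sigma_finite_measure_axioms)
  finally have "ennreal (\<integral>\<omega>. (?G \<omega>)\<^sup>2 \<partial>M) \<le> ennreal (norm (\<integral>x. (\<integral>y. (\<integral>\<omega>. g x \<omega> * g y \<omega> \<partial>M) \<partial>N) \<partial>N))"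
    by simp
  also have "\<dots> \<le> (\<integral>\<^sup>+x. norm (\<integral>y. (\<integral>\<omega>. g x \<omega> * g y \<omega> \<partial>M) \<partial>N) \<partial>N)"
    by (rule norm_integral_le_nn_integral)
  also have "\<dots> \<le> (\<integral>\<^sup>+x. \<integral>\<^sup>+y. norm (\<integral>\<omega>. g x \<omega> * g y \<omega> \<partial>M) \<partial>N \<partial>N)"
    by (intro nn_integral_mono norm_integral_le_nn_integral)
  finally show ?thesis by simp
qed

text \<open>The two factors are replaced by their Fourier integrals one at a time, and each
  frequency integral is exchanged with the integral over \<open>M\<close>. What remains inside is
  the joint characteristic function of \<open>U\<close> and \<open>V\<close> at
  \<open>(\<xi>, \<mu>)\<close>.\<close>

lemma expectation_Fourier_product_le:
  fixes U V :: "'a \<Rightarrow> real" and \<phi> :: "real \<Rightarrow> complex" and h :: "real \<Rightarrow> real"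
  assumes M: "finite_measure M" and [measurable]: "U \<in> borel_measurable M" "V \<in> borel_measurable M"
    "h \<in> borel_measurable borel"
    and \<phi>: "integrable lborel \<phi>"
    and h: "\<And>z. complex_of_real (h z) = (\<integral>\<xi>. \<phi> \<xi> * iexp (\<xi> * z) \<partial>lborel)"
  shows "ennreal \<bar>\<integral>\<omega>. h (U \<omega>) * h (V \<omega>) \<partial>M\<bar> \<le>
    (\<integral>\<^sup>+\<xi>. \<integral>\<^sup>+\<mu>. ennreal (norm (\<phi> \<xi>) * norm (\<phi> \<mu>) * norm (\<integral>\<omega>. iexp (\<xi> * U \<omega> + \<mu> * V \<omega>) \<partial>M)) \<partial>lborel \<partial>lborel)"
proof -
  have [measurable]: "\<phi> \<in> borel_measurable borel" using \<phi> by auto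
  \<comment> \<open>The Fourier representation bounds \<open>h\<close> by the integral of the norm
    of \<open>\<phi>\<close>; this is the domination for the first exchange.\<close>
  have hb: "norm (complex_of_real (h z)) \<le> (\<integral>\<xi>. norm (\<phi> \<xi>) \<partial>lborel)" for z
    unfolding h by (rule order_trans[OF integral_norm_bound]) (simp add: norm_mult)
  have "complex_of_real (\<integral>\<omega>. h (U \<omega>) * h (V \<omega>) \<partial>M) = (\<integral>\<omega>. complex_of_real (h (U \<omega>)) * complex_of_real (h (V \<omega>)) \<partial>M)"
    by (simp flip: of_real_mult)
  also have "\<dots> = (\<integral>\<omega>. (\<integral>\<xi>. \<phi> \<xi> * (iexp (\<xi> * U \<omega>) * complex_of_real (h (V \<omega>))) \<partial>lborel) \<partial>M)"
    unfolding h[of "U _"] by (simp flip: mult.assoc)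
  also have "\<dots> = (\<integral>\<xi>. \<phi> \<xi> * (\<integral>\<omega>. iexp (\<xi> * U \<omega>) * complex_of_real (h (V \<omega>)) \<partial>M) \<partial>lborel)"
    using hb by (intro Fubini_integral_weighted[where C="\<integral>\<xi>. norm (\<phi> \<xi>) \<partial>lborel"] M \<phi> lborel.sigma_finite_measure_axioms)
      (auto simp: norm_mult)
  also have "\<dots> = (\<integral>\<xi>. \<phi> \<xi> * (\<integral>\<omega>. (\<integral>\<mu>. \<phi> \<mu> * iexp (\<xi> * U \<omega> + \<mu> * V \<omega>) \<partial>lborel) \<partial>M) \<partial>lborel)"
  proof -
    have "iexp (\<xi> * U \<omega>) * complex_of_real (h (V \<omega>)) = (\<integral>\<mu>. \<phi> \<mu> * iexp (\<xi> * U \<omega> + \<mu> * V \<omega>) \<partial>lborel)" for \<xi> \<omega>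
      unfolding h of_real_add distrib_left exp_add
      by (subst integral_mult_right_zero[symmetric]) (simp only: mult_ac)
    then show ?thesis by simp
  qed
  also have "\<dots> = (\<integral>\<xi>. \<phi> \<xi> * (\<integral>\<mu>. \<phi> \<mu> * (\<integral>\<omega>. iexp (\<xi> * U \<omega> + \<mu> * V \<omega>) \<partial>M) \<partial>lborel) \<partial>lborel)"
    by (intro Bochner_Integration.integral_cong refl arg_cong2[where f="(*)"] Fubini_integral_weighted[where C=1]
        M \<phi> lborel.sigma_finite_measure_axioms) (auto simp del: of_real_add)
  finally have eq: "complex_of_real (\<integral>\<omega>. h (U \<omega>) * h (V \<omega>) \<partial>M) =
    (\<integral>\<xi>. \<phi> \<xi> * (\<integral>\<mu>. \<phi> \<mu> * (\<integral>\<omega>. iexp (\<xi> * U \<omega> + \<mu> * V \<omega>) \<partial>M) \<partial>lborel) \<partial>lborel)" .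
  have "ennreal \<bar>\<integral>\<omega>. h (U \<omega>) * h (V \<omega>) \<partial>M\<bar> = ennreal (norm (complex_of_real (\<integral>\<omega>. h (U \<omega>) * h (V \<omega>) \<partial>M)))"
    by simp
  also have "\<dots> \<le> (\<integral>\<^sup>+\<xi>. norm (\<phi> \<xi> * (\<integral>\<mu>. \<phi> \<mu> * (\<integral>\<omega>. iexp (\<xi> * U \<omega> + \<mu> * V \<omega>) \<partial>M) \<partial>lborel)) \<partial>lborel)"
    unfolding eq by (rule norm_integral_le_nn_integral)
  also have "\<dots> \<le> (\<integral>\<^sup>+\<xi>. \<integral>\<^sup>+\<mu>. ennreal (norm (\<phi> \<xi>) * norm (\<phi> \<mu>) * norm (\<integral>\<omega>. iexp (\<xi> * U \<omega> + \<mu> * V \<omega>) \<partial>M)) \<partial>lborel \<partial>lborel)"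
  proof (intro nn_integral_mono)
    fix \<xi> :: real
    have "ennreal (norm (\<phi> \<xi> * (\<integral>\<mu>. \<phi> \<mu> * (\<integral>\<omega>. iexp (\<xi> * U \<omega> + \<mu> * V \<omega>) \<partial>M) \<partial>lborel)))
      = norm (\<integral>\<mu>. \<phi> \<xi> * (\<phi> \<mu> * (\<integral>\<omega>. iexp (\<xi> * U \<omega> + \<mu> * V \<omega>) \<partial>M)) \<partial>lborel)"
      by simp
    also have "\<dots> \<le> (\<integral>\<^sup>+\<mu>. norm (\<phi> \<xi> * (\<phi> \<mu> * (\<integral>\<omega>. iexp (\<xi> * U \<omega> + \<mu> * V \<omega>) \<partial>M))) \<partial>lborel)"
      by (rule norm_integral_le_nn_integral)
    finally show "ennreal (norm (\<phi> \<xi> * (\<integral>\<mu>. \<phi> \<mu> * (\<integral>\<omega>. iexp (\<xi> * U \<omega> + \<mu> * V \<omega>) \<partial>M) \<partial>lborel))) \<le>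
      (\<integral>\<^sup>+\<mu>. ennreal (norm (\<phi> \<xi>) * norm (\<phi> \<mu>) * norm (\<integral>\<omega>. iexp (\<xi> * U \<omega> + \<mu> * V \<omega>) \<partial>M)) \<partial>lborel)"
      by (simp add: norm_mult mult.assoc del: of_real_add of_real_mult)
  qed
  finally show ?thesis .
qed

section \<open>Gaussian integrals and the Fourier transform of the kernel\<close>

lemma nn_integral_gaussian:
  assumes "a > 0"
  shows "(\<integral>\<^sup>+x. ennreal (exp (- (a * (x + b)\<^sup>2) / 2)) \<partial>lborel) = ennreal (sqrt (2 * pi / a))"
proof -
  have \<sigma>: "1 / sqrt a > 0" using assms by simp
  have eq: "exp (- (a * (x + b)\<^sup>2) / 2) = sqrt (2 * pi / a) * normal_density (- b) (1 / sqrt a) x" for x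
    using assms by (simp add: normal_density_def power_divide field_simps real_sqrt_mult real_sqrt_divide)
  show ?thesis
    unfolding eq using assms \<sigma> nn_integral_eq_integral[of lborel "normal_density (- b) (1 / sqrt a)"]
    by (simp add: ennreal_mult' nn_integral_cmult normal_density_nonneg)
qed

text \<open>Up to the factor \<open>sqrt (2 * pi / a)\<close> this is the second moment of the
  centred normal law with variance \<open>1 / a\<close>.\<close>

lemma nn_integral_gaussian_square:
  assumes "a > 0"
  shows "(\<integral>\<^sup>+x. ennreal (x\<^sup>2 * exp (- (a * x\<^sup>2) / 2)) \<partial>lborel) = ennreal (sqrt (2 * pi / a) / a)"
proof -
  have \<sigma>: "1 / sqrt a > 0" using assms by simp
  have eq: "x\<^sup>2 * exp (- (a * x\<^sup>2) / 2) = sqrt (2 * pi / a) * (normal_density 0 (1 / sqrt a) x * (x - 0)\<^sup>2)" for x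
    using assms by (simp add: normal_density_def power_divide field_simps real_sqrt_mult real_sqrt_divide)
  have "integrable lborel (\<lambda>x. normal_density 0 (1 / sqrt a) x * (x - 0)\<^sup>2)"
    by (rule integrable_normal_moment[OF \<sigma>])
  moreover have "(\<integral>x. normal_density 0 (1 / sqrt a) x * (x - 0)\<^sup>2 \<partial>lborel) = 1 / a"
    using integral_normal_moment_even[OF \<sigma>, of 0 1] assms by (simp add: power_divide)
  ultimately show ?thesis
    unfolding eq using assms nn_integral_eq_integral[of lborel "\<lambda>x. normal_density 0 (1 / sqrt a) x * (x - 0)\<^sup>2"]
    by (subst ennreal_mult', simp, subst nn_integral_cmult) (auto simp: normal_density_nonneg simp flip: ennreal_mult')
qed

text \<open>The Fourier transform of the Gaussian kernel centred at \<open>y\<close>, with the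
  factor \<open>1 / (2 * pi)\<close> of the inversion formula built in.\<close>

definition gauss_symbol :: "real \<Rightarrow> real \<Rightarrow> real \<Rightarrow> complex" where
  "gauss_symbol \<epsilon> y \<xi> = exp (- (\<epsilon> * \<xi>\<^sup>2) / 2) / (2 * pi) * iexp (- (\<xi> * y))"

lemma integrable_gauss_symbol:
  assumes "\<epsilon> > 0"
  shows "integrable lborel (gauss_symbol \<epsilon> y)"
proof (rule integrableI_bounded)
  show "gauss_symbol \<epsilon> y \<in> borel_measurable lborel"
    unfolding gauss_symbol_def by measurable
  have "(\<integral>\<^sup>+\<xi>. ennreal (norm (gauss_symbol \<epsilon> y \<xi>)) \<partial>lborel) =
      (\<integral>\<^sup>+\<xi>. ennreal (1 / (2 * pi)) * ennreal (exp (- (\<epsilon> * (\<xi> + 0)\<^sup>2) / 2)) \<partial>lborel)"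
    by (intro nn_integral_cong) (simp add: gauss_symbol_def norm_mult norm_divide flip: ennreal_mult')
  also have "\<dots> = ennreal (1 / (2 * pi)) * ennreal (sqrt (2 * pi / \<epsilon>))"
    by (subst nn_integral_cmult, measurable) (subst nn_integral_gaussian[OF assms], rule refl)
  also have "\<dots> < \<infinity>" by (simp add: ennreal_mult_less_top)
  finally show "(\<integral>\<^sup>+\<xi>. ennreal (norm (gauss_symbol \<epsilon> y \<xi>)) \<partial>lborel) < \<infinity>" .
qed

text \<open>The substitution \<open>\<xi> = x / sqrt \<epsilon>\<close> turns the integral into the
  characteristic function of the standard normal law at \<open>(z - y) / sqrt \<epsilon>\<close>,
  which is again Gaussian.\<close>

lemma gauss_kernel_Fourier:
  assumes "\<epsilon> > 0"
  shows "complex_of_real (gauss_kernel \<epsilon> y z) = (\<integral>\<xi>. gauss_symbol \<epsilon> y \<xi> * iexp (\<xi> * z) \<partial>lborel)"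
proof -
  let ?u = "(z - y) / sqrt \<epsilon>"
  have "(\<integral>\<xi>. gauss_symbol \<epsilon> y \<xi> * iexp (\<xi> * z) \<partial>lborel)
      = (\<integral>\<xi>. complex_of_real (exp (- (\<epsilon> * \<xi>\<^sup>2) / 2) / (2 * pi)) * iexp (\<xi> * (z - y)) \<partial>lborel)"
    by (intro Bochner_Integration.integral_cong) (auto simp: gauss_symbol_def right_diff_distrib exp_diff exp_minus field_simps)
  also have "\<dots> = (1 / sqrt \<epsilon>) *\<^sub>R (\<integral>x. complex_of_real (exp (- (\<epsilon> * (0 + 1 / sqrt \<epsilon> * x)\<^sup>2) / 2) / (2 * pi)) * iexp ((0 + 1 / sqrt \<epsilon> * x) * (z - y)) \<partial>lborel)"
    using assms by (subst lborel_integral_real_affine[where c="1 / sqrt \<epsilon>" and t=0]) auto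
  also have "(\<lambda>x. complex_of_real (exp (- (\<epsilon> * (0 + 1 / sqrt \<epsilon> * x)\<^sup>2) / 2) / (2 * pi)) * iexp ((0 + 1 / sqrt \<epsilon> * x) * (z - y)))
     = (\<lambda>x. complex_of_real (1 / sqrt (2 * pi)) * (std_normal_density x *\<^sub>R iexp (?u * x)))"
  proof
    fix x :: real
    have "exp (- (\<epsilon> * (0 + 1 / sqrt \<epsilon> * x)\<^sup>2) / 2) / (2 * pi) = 1 / sqrt (2 * pi) * std_normal_density x"
      using assms by (simp add: std_normal_density_def power_mult_distrib power_divide field_simps flip: real_sqrt_mult)
    moreover have "(0 + 1 / sqrt \<epsilon> * x) * (z - y) = ?u * x" by simp
    ultimately show "complex_of_real (exp (- (\<epsilon> * (0 + 1 / sqrt \<epsilon> * x)\<^sup>2) / 2) / (2 * pi)) * iexp ((0 + 1 / sqrt \<epsilon> * x) * (z - y))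
      = complex_of_real (1 / sqrt (2 * pi)) * (std_normal_density x *\<^sub>R iexp (?u * x))"
      by (simp only: scaleR_conv_of_real of_real_mult mult.assoc)
  qed
  also have "(\<integral>x. complex_of_real (1 / sqrt (2 * pi)) * (std_normal_density x *\<^sub>R iexp (?u * x)) \<partial>lborel)
    = complex_of_real (1 / sqrt (2 * pi)) * (\<integral>x. std_normal_density x *\<^sub>R iexp (?u * x) \<partial>lborel)"
    by (rule integral_mult_right_zero)
  also have "(\<integral>x. std_normal_density x *\<^sub>R iexp (?u * x) \<partial>lborel) = char std_normal_distribution ?u"
    unfolding char_def by (subst integral_density) (auto simp: normal_density_nonneg)
  also have "(1 / sqrt \<epsilon>) *\<^sub>R (complex_of_real (1 / sqrt (2 * pi)) * char std_normal_distribution ?u) = complex_of_real (gauss_kernel \<epsilon> y z)"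
    using assms by (simp add: char_std_normal_distribution gauss_kernel_def scaleR_conv_of_real power_divide
      real_sqrt_mult exp_of_real field_simps)
  finally show ?thesis ..
qed

section \<open>Gaussian estimates\<close>

text \<open>Interpolates between the bounds 1 and \<open>x\<close>. An exponent strictly between 0
  and 1/2 is wanted: it becomes the rate in \<open>\<delta>\<close>, which must be positive, and it
  adds to the 1/2 in the singularity of \<open>t - s\<close>, which must stay integrable.\<close>

lemma min_le_root4:
  fixes x :: real
  assumes "x \<ge> 0"
  shows "min 1 x \<le> x powr (1/4)"
proof (cases "x \<le> 1")
  case True
  then show ?thesis using assms powr_mono'[of "1/4" 1 x] by (cases "x = 0") auto
next
  case False
  then show ?thesis using ge_one_powr_ge_zero[of x "1/4"] by auto
qed

text \<open>Bounding \<open>\<psi> x\<close> by 1 gives the total Gaussian mass, and bounding it by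
  \<open>\<eta> * x^2\<close> gives a second moment, equal to that mass times
  \<open>\<eta> / v\<close>. The minimum of the two is relaxed by
  \<open>min_le_root4\<close>.\<close>

lemma nn_integral_truncated_gaussian_le:
  assumes v: "v > 0" and \<eta>: "\<eta> \<ge> 0"
    and \<psi>: "\<And>x. \<psi> x \<le> 1" "\<And>x. \<psi> x \<le> \<eta> * x\<^sup>2"
  shows "(\<integral>\<^sup>+x. ennreal (\<psi> x * exp (- (v * x\<^sup>2) / 2)) \<partial>lborel) \<le> ennreal (sqrt (2 * pi / v) * (\<eta> / v) powr (1/4))"
proof -
  let ?I = "\<integral>\<^sup>+x. ennreal (\<psi> x * exp (- (v * x\<^sup>2) / 2)) \<partial>lborel"
  have "?I \<le> (\<integral>\<^sup>+x. ennreal (exp (- (v * (x + 0)\<^sup>2) / 2)) \<partial>lborel)"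
    using \<psi>(1) by (intro nn_integral_mono ennreal_leI) simp
  also have "\<dots> = ennreal (sqrt (2 * pi / v))" by (rule nn_integral_gaussian[OF v])
  finally have 1: "?I \<le> ennreal (sqrt (2 * pi / v) * 1)" by simp
  have "?I \<le> (\<integral>\<^sup>+x. ennreal \<eta> * ennreal (x\<^sup>2 * exp (- (v * x\<^sup>2) / 2)) \<partial>lborel)"
    using \<psi>(2) \<eta> by (intro nn_integral_mono) (auto simp flip: ennreal_mult' mult.assoc intro!: ennreal_leI mult_right_mono)
  also have "\<dots> = ennreal \<eta> * ennreal (sqrt (2 * pi / v) / v)"
    by (subst nn_integral_cmult, measurable) (subst nn_integral_gaussian_square[OF v], rule refl)
  also have "\<dots> = ennreal (sqrt (2 * pi / v) * (\<eta> / v))"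
    using \<eta> v by (simp add: mult.commute flip: ennreal_mult)
  finally have 2: "?I \<le> ennreal (sqrt (2 * pi / v) * (\<eta> / v))" .
  have "?I \<le> ennreal (sqrt (2 * pi / v) * min 1 (\<eta> / v))"
    using 1 2 by (auto simp: min_def)
  also have "\<dots> \<le> ennreal (sqrt (2 * pi / v) * (\<eta> / v) powr (1/4))"
    using \<eta> v min_le_root4[of "\<eta> / v"] by (intro ennreal_leI mult_left_mono) auto
  finally show ?thesis .
qed

text \<open>For fixed \<open>x\<close> the integral over \<open>y\<close> is bounded by a full
  Gaussian integral, whose value does not depend on its centre \<open>- \<beta> * x\<close>. The
  truncated Gaussian integral in \<open>x\<close> is left.\<close>

lemma nn_integral_gaussian_form_le:
  fixes \<psi> :: "real \<Rightarrow> real" and Q :: "real \<Rightarrow> real \<Rightarrow> real"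
  assumes [measurable]: "\<psi> \<in> borel_measurable borel" and a: "a > 0" and v: "v > 0" and \<eta>: "\<eta> \<ge> 0"
    and \<psi>: "\<And>x. 0 \<le> \<psi> x" "\<And>x. \<psi> x \<le> 1" "\<And>x. \<psi> x \<le> \<eta> * x\<^sup>2"
    and Q: "\<And>x y. a * (y + \<beta> * x)\<^sup>2 + v * x\<^sup>2 \<le> Q x y"
  shows "(\<integral>\<^sup>+x. \<integral>\<^sup>+y. ennreal (\<psi> x * \<psi> y * exp (- Q x y / 2)) \<partial>lborel \<partial>lborel) \<le>
    ennreal (2 * pi / sqrt (a * v) * (\<eta> / v) powr (1/4))"
proof -
  have "(\<integral>\<^sup>+y. ennreal (\<psi> x * \<psi> y * exp (- Q x y / 2)) \<partial>lborel) \<le>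
      ennreal (sqrt (2 * pi / a)) * ennreal (\<psi> x * exp (- (v * x\<^sup>2) / 2))" for x
  proof -
    have "(\<integral>\<^sup>+y. ennreal (\<psi> x * \<psi> y * exp (- Q x y / 2)) \<partial>lborel) \<le>
      (\<integral>\<^sup>+y. ennreal (\<psi> x * exp (- (v * x\<^sup>2) / 2)) * ennreal (exp (- (a * (y + \<beta> * x)\<^sup>2) / 2)) \<partial>lborel)"
    proof (intro nn_integral_mono)
      fix y
      \<comment> \<open>\<open>\<psi> y\<close> is only bounded by 1; the smallness in
        \<open>\<eta>\<close> comes from \<open>\<psi> x\<close>.\<close>
      have "\<psi> x * \<psi> y * exp (- Q x y / 2) \<le> \<psi> x * 1 * exp (- (v * x\<^sup>2) / 2 + - (a * (y + \<beta> * x)\<^sup>2) / 2)"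
        using \<psi> Q[of y x] by (intro mult_mono) auto
      then show "ennreal (\<psi> x * \<psi> y * exp (- Q x y / 2)) \<le>
          ennreal (\<psi> x * exp (- (v * x\<^sup>2) / 2)) * ennreal (exp (- (a * (y + \<beta> * x)\<^sup>2) / 2))"
        using \<psi>(1)[of x] unfolding exp_add by (simp add: mult.assoc ennreal_leI flip: ennreal_mult)
    qed
    also have "\<dots> = ennreal (\<psi> x * exp (- (v * x\<^sup>2) / 2)) * ennreal (sqrt (2 * pi / a))"
      by (subst nn_integral_cmult, measurable) (subst nn_integral_gaussian[OF a], rule refl)
    finally show ?thesis by (simp only: mult.commute)
  qed
  then have "(\<integral>\<^sup>+x. \<integral>\<^sup>+y. ennreal (\<psi> x * \<psi> y * exp (- Q x y / 2)) \<partial>lborel \<partial>lborel) \<le>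
      (\<integral>\<^sup>+x. ennreal (sqrt (2 * pi / a)) * ennreal (\<psi> x * exp (- (v * x\<^sup>2) / 2)) \<partial>lborel)"
    by (intro nn_integral_mono)
  also have "\<dots> \<le> ennreal (sqrt (2 * pi / a)) * (\<integral>\<^sup>+x. ennreal (\<psi> x * exp (- (v * x\<^sup>2) / 2)) \<partial>lborel)"
    by (subst nn_integral_cmult) simp_all
  also have "\<dots> \<le> ennreal (sqrt (2 * pi / a)) * ennreal (sqrt (2 * pi / v) * (\<eta> / v) powr (1/4))"
    using v \<eta> \<psi> by (intro mult_left_mono nn_integral_truncated_gaussian_le) auto
  also have "\<dots> = ennreal (2 * pi / sqrt (a * v) * (\<eta> / v) powr (1/4))"
  proof -
    have "(2 * pi / a) * (2 * pi / v) = (2 * pi)\<^sup>2 / (a * v)" by (simp add: power2_eq_square)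
    then have "sqrt (2 * pi / a) * sqrt (2 * pi / v) = 2 * pi / sqrt (a * v)"
      by (metis real_sqrt_mult real_sqrt_divide real_sqrt_abs abs_of_pos pi_gt_zero zero_less_mult_iff zero_less_numeral)
    then show ?thesis using a v by (simp flip: ennreal_mult mult.assoc)
  qed
  finally show ?thesis .
qed

text \<open>The time singularity of the correlation bound. It is cut off in \<open>r - s\<close>
  rather than in \<open>r\<close>, so that the integral of the second factor over \<open>r\<close>
  does not depend on \<open>s\<close>. At \<open>s = 0\<close> and at \<open>r = s\<close> the value
  is 0, because \<open>0 powr a = 0\<close>.\<close>

definition singular_kernel :: "real \<Rightarrow> real \<Rightarrow> real" where
  "singular_kernel s r = indicator {0..1} s * s powr (-1/2) * (indicator {0..1} (r - s) * (r - s) powr (-3/4))"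

lemma singular_kernel_measurable [measurable]: "case_prod singular_kernel \<in> borel_measurable (lborel \<Otimes>\<^sub>M lborel)"
  unfolding singular_kernel_def by measurable

lemma singular_kernel_nonneg: "0 \<le> singular_kernel s r"
  by (simp add: singular_kernel_def)

lemma nn_integral_powr_unit:
  fixes a :: real
  assumes "a > -1"
  shows "(\<integral>\<^sup>+x. ennreal (indicator {0..1} x * x powr a) \<partial>lborel) = ennreal (1 / (a + 1))"
proof (rule nn_integral_has_integral_lborel)
  show "(\<lambda>x::real. indicator {0..1} x * x powr a) \<in> borel_measurable borel" by measurable
  have "((\<lambda>x. x powr a) has_integral 1 / (a + 1)) {0..1::real}"
    using has_integral_powr_from_0[OF assms, of 1] by simp
  then have "((\<lambda>x. if x \<in> {0..1} then x powr a else 0) has_integral 1 / (a + 1)) UNIV"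
    by (simp only: has_integral_restrict_UNIV)
  also have "(\<lambda>x. if x \<in> {0..1} then x powr a else 0) = (\<lambda>x::real. indicator {0..1} x * x powr a)"
    by (auto simp: indicator_def)
  finally show "((\<lambda>x. indicator {0..1} x * x powr a) has_integral 1 / (a + 1)) UNIV" .
qed auto

text \<open>Translating \<open>r\<close> by \<open>s\<close> separates the variables; the factors
  are \<open>1 / (1 - 1/2) = 2\<close> and \<open>1 / (1 - 3/4) = 4\<close>. Both orders of
  integration are recorded because the kernel is later symmetrised.\<close>

lemma nn_integral_singular_kernel:
  "(\<integral>\<^sup>+s. \<integral>\<^sup>+r. ennreal (singular_kernel s r) \<partial>lborel \<partial>lborel) = 8"
  "(\<integral>\<^sup>+r. \<integral>\<^sup>+s. ennreal (singular_kernel s r) \<partial>lborel \<partial>lborel) = 8"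
proof -
  let ?k = "\<lambda>s::real. indicator {0..1} s * s powr (-1/2)" and ?l = "\<lambda>u::real. indicator {0..1} u * u powr (-3/4)"
  have "(\<integral>\<^sup>+r. ennreal (singular_kernel s r) \<partial>lborel) = 4 * ennreal (?k s)" for s
  proof -
    have "(\<integral>\<^sup>+r. ennreal (singular_kernel s r) \<partial>lborel) = (\<integral>\<^sup>+r. ennreal (?k s) * ennreal (?l (r - s)) \<partial>lborel)"
      by (intro nn_integral_cong) (simp add: singular_kernel_def flip: ennreal_mult)
    also have "\<dots> = ennreal (?k s) * (\<integral>\<^sup>+r. ennreal (?l (r - s)) \<partial>lborel)"
      by (intro nn_integral_cmult) measurable
    also have "(\<integral>\<^sup>+r. ennreal (?l (r - s)) \<partial>lborel) = (\<integral>\<^sup>+u. ennreal (?l u) \<partial>lborel)"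
      by (subst nn_integral_real_affine[of _ 1 s]) simp_all
    also have "\<dots> = 4" by (subst nn_integral_powr_unit) auto
    finally show ?thesis by (simp only: mult.commute)
  qed
  then have "(\<integral>\<^sup>+s. \<integral>\<^sup>+r. ennreal (singular_kernel s r) \<partial>lborel \<partial>lborel) = 4 * (\<integral>\<^sup>+s. ennreal (?k s) \<partial>lborel)"
    by (simp add: nn_integral_cmult)
  also have "(\<integral>\<^sup>+s. ennreal (?k s) \<partial>lborel) = 2" by (subst nn_integral_powr_unit) auto
  finally show 1: "(\<integral>\<^sup>+s. \<integral>\<^sup>+r. ennreal (singular_kernel s r) \<partial>lborel \<partial>lborel) = 8" by simp
  show "(\<integral>\<^sup>+r. \<integral>\<^sup>+s. ennreal (singular_kernel s r) \<partial>lborel \<partial>lborel) = 8"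
    using lborel_pair.Fubini[of "\<lambda>(s, r). ennreal (singular_kernel s r)"] 1 by simp
qed

section \<open>Correlations of the Gaussian kernels\<close>

lemma wiener_integral_square_integrable:
  assumes "wiener_integral M W 0 t f I"
  shows "square_integrable M I" "square_integrable lborel (\<lambda>r. indicator {0..t} r * f r)"
proof -
  obtain n p c where f: "L2_tendsto (restrict_space lborel {0..t}) (\<lambda>k. step_function (n k) (p k) (c k)) f sequentially"
    and I: "L2_tendsto M (\<lambda>k. step_integral W (n k) (p k) (c k)) I sequentially"
    using assms unfolding wiener_integral_def by auto
  show "square_integrable M I" using I by (simp add: L2_tendsto_def)
  show "square_integrable lborel (\<lambda>r. indicator {0..t} r * f r)"
    using L2_tendsto_restrict_space[OF _ f] by (simp add: L2_tendsto_def)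
qed

text \<open>Both exponentials lie between 0 and 1, and also between
  \<open>1 - \<delta> * \<xi>^2 / 2\<close> and 1; the phase has modulus 1, and
  \<open>1 / (2 * pi)\<close> is less than 1.\<close>

lemma gauss_symbol_diff_bounds:
  assumes "0 < \<epsilon>" "\<epsilon> \<le> \<delta>"
  shows "norm (gauss_symbol \<delta> y \<xi> - gauss_symbol \<epsilon> y \<xi>) \<le> 1"
    and "norm (gauss_symbol \<delta> y \<xi> - gauss_symbol \<epsilon> y \<xi>) \<le> \<delta> * \<xi>\<^sup>2"
proof -
  let ?d = "exp (- (\<delta> * \<xi>\<^sup>2) / 2)" and ?e = "exp (- (\<epsilon> * \<xi>\<^sup>2) / 2)"
  have "gauss_symbol \<delta> y \<xi> - gauss_symbol \<epsilon> y \<xi> = complex_of_real ((?d - ?e) / (2 * pi)) * iexp (- (\<xi> * y))"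
    by (simp add: gauss_symbol_def left_diff_distrib diff_divide_distrib)
  then have n: "norm (gauss_symbol \<delta> y \<xi> - gauss_symbol \<epsilon> y \<xi>) = \<bar>?d - ?e\<bar> / (2 * pi)"
    by (simp only: norm_mult norm_exp_i_times norm_of_real) (simp add: abs_divide)
  have "\<epsilon> * \<xi>\<^sup>2 \<le> \<delta> * \<xi>\<^sup>2" using assms by (intro mult_right_mono) auto
  then have de: "?d \<le> ?e" by simp
  have e1: "?e \<le> 1" using assms by simp
  have d: "?d \<ge> 1 - \<delta> * \<xi>\<^sup>2 / 2" using exp_ge_add_one_self[of "- (\<delta> * \<xi>\<^sup>2) / 2"] by simp
  have q: "\<delta> * \<xi>\<^sup>2 \<ge> 0" using assms by simp
  have le: "\<bar>?d - ?e\<bar> / (2 * pi) \<le> \<bar>?d - ?e\<bar>"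
    using pi_gt3 by (simp add: divide_le_eq mult_le_cancel_left1)
  show "norm (gauss_symbol \<delta> y \<xi> - gauss_symbol \<epsilon> y \<xi>) \<le> 1"
    unfolding n using le de e1 exp_gt_zero[of "- (\<delta> * \<xi>\<^sup>2) / 2"] by linarith
  show "norm (gauss_symbol \<delta> y \<xi> - gauss_symbol \<epsilon> y \<xi>) \<le> \<delta> * \<xi>\<^sup>2"
    unfolding n using le de e1 d q by linarith
qed

lemma gauss_kernel_bounds:
  assumes "\<epsilon> > 0"
  shows "0 \<le> gauss_kernel \<epsilon> y z" "gauss_kernel \<epsilon> y z \<le> 1 / sqrt (2 * pi * \<epsilon>)"
proof -
  show "0 \<le> gauss_kernel \<epsilon> y z" using assms by (simp add: gauss_kernel_def)
  have "exp (- (z - y)\<^sup>2 / (2 * \<epsilon>)) \<le> 1" using assms by (simp add: divide_nonpos_pos)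
  then show "gauss_kernel \<epsilon> y z \<le> 1 / sqrt (2 * pi * \<epsilon>)"
    using assms unfolding gauss_kernel_def by (intro mult_left_le) auto
qed

lemma gauss_kernel_measurable [measurable]: "gauss_kernel \<epsilon> y \<in> borel_measurable borel"
  unfolding gauss_kernel_def by measurable

text \<open>Powers are collected: the exponents 1/2 and 1/4 of \<open>t - s\<close> add up to 3/4,
  and \<open>m powr (1/2)\<close> is the fourth root of \<open>m^2\<close>. In the given range of
  \<open>s\<close> and \<open>t\<close> both cut-offs of the kernel equal 1.\<close>

lemma Gaussian_bound_eq_singular_kernel:
  assumes "m > 0" "0 < s" "s < t" "t \<le> 1" "\<delta> > 0"
  shows "2 * pi / sqrt ((m\<^sup>2 * s) * (m\<^sup>2 * (t - s))) * (\<delta> / (m\<^sup>2 * (t - s))) powr (1/4) =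
    2 * pi / (m\<^sup>2 * m powr (1/2)) * \<delta> powr (1/4) * singular_kernel s t"
proof -
  have "sqrt ((m\<^sup>2 * s) * (m\<^sup>2 * (t - s))) = m\<^sup>2 * (s powr (1/2) * (t - s) powr (1/2))"
    using assms by (simp add: real_sqrt_mult powr_half_sqrt power2_eq_square)
  moreover have "(m\<^sup>2) powr (1/4) = m powr (1/2)"
    using assms powr_powr[of m 2 "1/4"] by simp
  moreover have "(t - s) powr (-3/4) = 1 / ((t - s) powr (1/2) * (t - s) powr (1/4))"
    using powr_add[of "t - s" "1/2" "1/4"] by (simp add: powr_minus_divide)
  moreover have "s powr (-1/2) = 1 / s powr (1/2)" by (simp add: powr_minus_divide)
  ultimately show ?thesis
    using assms by (simp add: singular_kernel_def powr_divide powr_mult)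
qed

context wiener_process begin

text \<open>Combines the Fourier bound, the joint characteristic function and the quadratic form
  estimate, with \<open>a = m^2 * s\<close>, \<open>v = m^2 * (t - s)\<close> and
  \<open>\<eta> = \<delta>\<close> in the Gaussian form bound. The later time comes first, since its
  frequency \<open>x\<close> is the variable left after completing the square in
  \<open>y\<close>.\<close>

lemma gauss_kernel_diff_correlation_le:
  assumes I: "wiener_integral M W 0 s f I" and J: "wiener_integral M W 0 t g J"
    and st: "0 < s" "s < t" "t \<le> 1" and m: "m > 0"
    and f: "\<And>r. r \<in> {0..s} \<Longrightarrow> m \<le> \<bar>f r\<bar>" and g: "\<And>r. r \<in> {0..t} \<Longrightarrow> m \<le> \<bar>g r\<bar>"
    and \<epsilon>\<delta>: "0 < \<epsilon>" "\<epsilon> \<le> \<delta>"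
    and h: "\<And>z. h z = gauss_kernel \<delta> y z - gauss_kernel \<epsilon> y z"
  shows "ennreal \<bar>expectation (\<lambda>\<omega>. h (J \<omega>) * h (I \<omega>))\<bar> \<le>
    ennreal (2 * pi / (m\<^sup>2 * m powr (1/2)) * \<delta> powr (1/4) * singular_kernel s t)"
proof -
  let ?\<phi> = "\<lambda>\<xi>. gauss_symbol \<delta> y \<xi> - gauss_symbol \<epsilon> y \<xi>"
  let ?Q = "\<lambda>x y. \<integral>r. (x * (indicator {0..t} r * g r) + y * (indicator {0..s} r * f r))\<^sup>2 \<partial>lborel"
  have [measurable]: "I \<in> borel_measurable M" "J \<in> borel_measurable M"
    using wiener_integral_square_integrable(1)[OF I] wiener_integral_square_integrable(1)[OF J]
    by (auto simp: square_integrable_def)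
  have [measurable]: "h \<in> borel_measurable borel" unfolding h by measurable
  have sym: "integrable lborel (gauss_symbol \<delta> y)" "integrable lborel (gauss_symbol \<epsilon> y)"
    using \<epsilon>\<delta> by (auto intro!: integrable_gauss_symbol)
  then have \<phi>: "integrable lborel ?\<phi>" by (rule Bochner_Integration.integrable_diff)
  have [measurable]: "?\<phi> \<in> borel_measurable borel" using \<phi> by auto
  have iexp_int: "integrable lborel (\<lambda>\<xi>. \<psi> \<xi> * iexp (\<xi> * z))" if "integrable lborel \<psi>" for \<psi> :: "real \<Rightarrow> complex" and z
  proof (rule Bochner_Integration.integrable_bound[OF that])
    have [measurable]: "\<psi> \<in> borel_measurable borel" using that by auto
    show "(\<lambda>\<xi>. \<psi> \<xi> * iexp (\<xi> * z)) \<in> borel_measurable lborel" by measurable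
  qed (simp add: norm_mult)
  have hF: "complex_of_real (h z) = (\<integral>\<xi>. ?\<phi> \<xi> * iexp (\<xi> * z) \<partial>lborel)" for z
    unfolding h left_diff_distrib
    using \<epsilon>\<delta> iexp_int[OF sym(1)] iexp_int[OF sym(2)]
    by (subst Bochner_Integration.integral_diff) (simp_all add: gauss_kernel_Fourier)
  obtain \<beta> where \<beta>: "\<And>x y. m\<^sup>2 * s * (y + \<beta> * x)\<^sup>2 + m\<^sup>2 * (t - s) * x\<^sup>2 \<le> ?Q x y"
    using quadratic_form_lower_bound[OF st(1,2) m wiener_integral_square_integrable(2)[OF I]
        wiener_integral_square_integrable(2)[OF J] f g] by blast
  have "ennreal \<bar>expectation (\<lambda>\<omega>. h (J \<omega>) * h (I \<omega>))\<bar> \<le>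
    (\<integral>\<^sup>+x. \<integral>\<^sup>+y. ennreal (norm (?\<phi> x) * norm (?\<phi> y) * norm (expectation (\<lambda>\<omega>. iexp (x * J \<omega> + y * I \<omega>)))) \<partial>lborel \<partial>lborel)"
    by (intro expectation_Fourier_product_le \<phi> hF finite_measure_axioms) measurable
  also have "\<dots> = (\<integral>\<^sup>+x. \<integral>\<^sup>+y. ennreal (norm (?\<phi> x) * norm (?\<phi> y) * exp (- ?Q x y / 2)) \<partial>lborel \<partial>lborel)"
    using st by (subst char_wiener_integrals[OF J I]) (simp_all only: norm_of_real abs_exp_cancel)
  also have "\<dots> \<le> ennreal (2 * pi / sqrt ((m\<^sup>2 * s) * (m\<^sup>2 * (t - s))) * (\<delta> / (m\<^sup>2 * (t - s))) powr (1/4))"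
    using st m \<epsilon>\<delta> gauss_symbol_diff_bounds[OF \<epsilon>\<delta>]
    by (intro nn_integral_gaussian_form_le[OF _ _ _ _ _ _ _ \<beta>]) auto
  also have "2 * pi / sqrt ((m\<^sup>2 * s) * (m\<^sup>2 * (t - s))) * (\<delta> / (m\<^sup>2 * (t - s))) powr (1/4) =
    2 * pi / (m\<^sup>2 * m powr (1/2)) * \<delta> powr (1/4) * singular_kernel s t"
    using st m \<epsilon>\<delta> by (intro Gaussian_bound_eq_singular_kernel) auto
  finally show ?thesis .
qed

end

section \<open>Existence of the local time\<close>

lemma approx_local_time_eq:
  "approx_local_time X \<epsilon> t y \<omega> = (\<integral>s. gauss_kernel \<epsilon> y (X s \<omega>) \<partial>restrict_space lborel {0..t})"
  by (simp add: approx_local_time_def set_lebesgue_integral_def integral_restrict_space)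

lemma measurable_restrict_time:
  assumes X: "(\<lambda>(t, \<omega>). X t \<omega>) \<in> borel_measurable (restrict_space borel {0..1} \<Otimes>\<^sub>M M)" and "t \<le> (1::real)"
  shows "(\<lambda>(s, \<omega>). X s \<omega>) \<in> borel_measurable (restrict_space lborel {0..t} \<Otimes>\<^sub>M M)"
proof -
  have "(\<lambda>s. s) \<in> restrict_space lborel {0..t} \<rightarrow>\<^sub>M restrict_space borel {0..1}"
    using assms(2) by (intro measurable_restrict_space2 measurable_restrict_space1) (auto simp: space_restrict_space)
  then have "(\<lambda>p. (fst p, snd p)) \<in> restrict_space lborel {0..t} \<Otimes>\<^sub>M M \<rightarrow>\<^sub>M restrict_space borel {0..1} \<Otimes>\<^sub>M M"
    by (intro measurable_Pair measurable_snd measurable_compose[OF measurable_fst]) simp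
  from measurable_compose[OF this X] show ?thesis by (simp add: split_beta)
qed

text \<open>\<open>F\<close> is bounded for \<open>s < r\<close>; symmetry supplies the other half,
  so two copies of the kernel with swapped arguments are added, and 8 + 8 gives the constant
  16.\<close>

lemma nn_integral_singular_kernel_restrict_le:
  assumes t: "t \<le> 1" and c: "0 \<le> c"
    and F: "\<And>s r. 0 < s \<Longrightarrow> s < r \<Longrightarrow> r \<le> t \<Longrightarrow> F s r \<le> ennreal (c * singular_kernel s r)"
    and sym: "\<And>s r. F s r = F r s"
  shows "(\<integral>\<^sup>+s. \<integral>\<^sup>+r. F s r \<partial>restrict_space lborel {0..t} \<partial>restrict_space lborel {0..t}) \<le> ennreal (16 * c)"
proof -
  let ?N = "restrict_space lborel {0..t::real}"
  let ?H = "\<lambda>s r. ennreal c * (ennreal (singular_kernel s r) + ennreal (singular_kernel r s))"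
  have le: "F s r \<le> ?H s r" if sr: "0 < s" "0 < r" "s \<noteq> r" "s \<le> t" "r \<le> t" for s r
  proof (cases "s < r")
    case True
    then have "F s r \<le> ennreal c * ennreal (singular_kernel s r)"
      using F[of s r] sr c by (simp add: ennreal_mult singular_kernel_nonneg)
    also have "\<dots> \<le> ?H s r" by (intro mult_left_mono) auto
    finally show ?thesis .
  next
    case False
    then have "F s r \<le> ennreal c * ennreal (singular_kernel r s)"
      using F[of r s] sr c by (simp add: ennreal_mult singular_kernel_nonneg sym[of s r])
    also have "\<dots> \<le> ?H s r" by (intro mult_left_mono) auto
    finally show ?thesis .
  qed
  \<comment> \<open>The axes and the diagonal, where no bound is available, are discarded as null
    sets.\<close>
  have AE_neq: "AE r in lborel. r \<noteq> a" for a :: real by (rule AE_lborel_singleton)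
  have inner: "(\<integral>\<^sup>+r. F s r \<partial>?N) \<le> (\<integral>\<^sup>+r. ?H s r \<partial>lborel)" if "0 < s" "s \<le> t" for s
  proof -
    have "(\<integral>\<^sup>+r. F s r \<partial>?N) = (\<integral>\<^sup>+r. F s r * indicator {0..t} r \<partial>lborel)"
      by (simp add: nn_integral_restrict_space)
    also have "\<dots> \<le> (\<integral>\<^sup>+r. ?H s r \<partial>lborel)"
      using AE_neq[of 0] AE_neq[of s]
      by (intro nn_integral_mono_AE, eventually_elim) (use le that in \<open>auto simp: indicator_def\<close>)
    finally show ?thesis .
  qed
  have "(\<integral>\<^sup>+s. \<integral>\<^sup>+r. F s r \<partial>?N \<partial>?N) = (\<integral>\<^sup>+s. (\<integral>\<^sup>+r. F s r \<partial>?N) * indicator {0..t} s \<partial>lborel)"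
    by (simp add: nn_integral_restrict_space)
  also have "\<dots> \<le> (\<integral>\<^sup>+s. \<integral>\<^sup>+r. ?H s r \<partial>lborel \<partial>lborel)"
    using AE_neq[of 0]
    by (intro nn_integral_mono_AE, eventually_elim) (use inner in \<open>auto simp: indicator_def\<close>)
  also have "\<dots> = ennreal c * ((\<integral>\<^sup>+s. \<integral>\<^sup>+r. ennreal (singular_kernel s r) \<partial>lborel \<partial>lborel) +
      (\<integral>\<^sup>+s. \<integral>\<^sup>+r. ennreal (singular_kernel r s) \<partial>lborel \<partial>lborel))"
    by (simp add: nn_integral_cmult nn_integral_add)
  also have "\<dots> = ennreal (16 * c)"
    using c by (simp add: nn_integral_singular_kernel ennreal_mult mult.commute)
  finally show ?thesis .
qed

theorem lemma4p1:
  fixes M :: "'a measure" and W X :: "real \<Rightarrow> 'a \<Rightarrow> real" and K :: "real \<times> real \<Rightarrow> real"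
  assumes "continuous_on ({0..1} \<times> {0..1}) K"
    and "(INF q \<in> {0..1} \<times> {0..1}. \<bar>K q\<bar>) \<noteq> 0"
    and "wiener_process M W"
    and "\<And>t. t \<in> {0..1} \<Longrightarrow> wiener_integral M W 0 t (\<lambda>s. K (t, s)) (X t)"
    and "(\<lambda>(t, \<omega>). X t \<omega>) \<in> borel_measurable (restrict_space borel {0..1} \<Otimes>\<^sub>M M)"
  shows "\<forall>y. \<forall>t\<in>{0..1}. local_time_exists M X t y"
proof (intro allI ballI)
  interpret wiener_process M W by fact
  note X = assms(4)
  fix y t :: real assume t: "t \<in> {0..1}"
  \<comment> \<open>The infimum is nonnegative because every value of \<open>\<bar>K q\<bar>\<close>
    is, so being nonzero makes it a positive lower bound.\<close>
  define m where "m = (INF q \<in> {0..1} \<times> {0..1}. \<bar>K q\<bar>)"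
  have m_le: "m \<le> \<bar>K (r, s)\<bar>" if "r \<in> {0..1}" "s \<in> {0..1}" for r s
    unfolding m_def using that by (intro cINF_lower bdd_belowI2[where m=0]) auto
  have "0 \<le> m" unfolding m_def by (rule cINF_greatest) auto
  then have m: "m > 0" using assms(2) by (simp add: m_def)
  let ?N = "restrict_space lborel {0..t}"
  let ?f = "\<lambda>\<epsilon>. approx_local_time X \<epsilon> t y"
  have XN[measurable]: "(\<lambda>(s, \<omega>). X s \<omega>) \<in> borel_measurable (?N \<Otimes>\<^sub>M M)"
    using t by (intro measurable_restrict_time assms(5)) auto
  have XN'[measurable]: "(\<lambda>(\<omega>, s). X s \<omega>) \<in> borel_measurable (M \<Otimes>\<^sub>M ?N)"
    using measurable_compose[OF measurable_pair_swap' XN] by (simp add: split_beta)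
  have finN: "finite_measure ?N"
    by (rule finite_measureI) (use t in \<open>simp add: emeasure_restrict_space space_restrict_space\<close>)
  interpret N: finite_measure ?N by (rule finN)
  have kernel_int: "integrable ?N (\<lambda>s. gauss_kernel \<epsilon> y (X s \<omega>))" if "\<epsilon> > 0" "\<omega> \<in> space M" for \<epsilon> \<omega>
    using gauss_kernel_bounds[OF that(1)] that(2)
    by (intro N.integrable_const_bound[where B="1 / sqrt (2 * pi * \<epsilon>)"]) auto
  \<comment> \<open>For fixed \<open>\<epsilon>\<close> the kernel is bounded and the time interval
    has finite length, so \<open>?f \<epsilon>\<close> is bounded.\<close>
  have sq: "square_integrable M (?f \<epsilon>)" if \<epsilon>: "\<epsilon> > 0" for \<epsilon>
  proof -
    let ?B = "1 / sqrt (2 * pi * \<epsilon>) * measure ?N (space ?N)"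
    have [measurable]: "?f \<epsilon> \<in> borel_measurable M"
      unfolding approx_local_time_eq[abs_def] by measurable
    have "\<bar>?f \<epsilon> \<omega>\<bar> \<le> ?B" if "\<omega> \<in> space M" for \<omega>
    proof -
      have "\<bar>?f \<epsilon> \<omega>\<bar> \<le> (\<integral>s. \<bar>gauss_kernel \<epsilon> y (X s \<omega>)\<bar> \<partial>?N)"
        unfolding approx_local_time_eq by (rule integral_abs_bound)
      also have "\<dots> \<le> (\<integral>s. 1 / sqrt (2 * pi * \<epsilon>) \<partial>?N)"
        using gauss_kernel_bounds[OF \<epsilon>] kernel_int[OF \<epsilon> that] by (intro integral_mono) auto
      finally show ?thesis by (simp add: mult.commute)
    qed
    then have "\<bar>?f \<epsilon> \<omega>\<bar>\<^sup>2 \<le> ?B\<^sup>2" if "\<omega> \<in> space M" for \<omega>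
      using that by (intro power_mono) auto
    then have "integrable M (\<lambda>\<omega>. (?f \<epsilon> \<omega>)\<^sup>2)"
      by (intro integrable_const_bound[where B="?B\<^sup>2"]) auto
    then show ?thesis by (simp add: square_integrable_def)
  qed
  let ?C = "2 * pi / (m\<^sup>2 * m powr (1/2))"
  have incr: "expectation (\<lambda>\<omega>. (?f \<delta> \<omega> - ?f \<epsilon> \<omega>)\<^sup>2) \<le> 16 * ?C * \<delta> powr (1/4)"
    if \<epsilon>\<delta>: "0 < \<epsilon>" "\<epsilon> \<le> \<delta>" for \<epsilon> \<delta>
  proof -
    \<comment> \<open>By linearity the difference of the two approximate local times is the time
      integral of \<open>h\<close>; its second moment is at most a double time integral of
      correlations.\<close>
    define h where "h z = gauss_kernel \<delta> y z - gauss_kernel \<epsilon> y z" for z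
    have [measurable]: "h \<in> borel_measurable borel" unfolding h_def[abs_def] by measurable
    have hb: "\<bar>h z\<bar> \<le> 1 / sqrt (2 * pi * \<delta>) + 1 / sqrt (2 * pi * \<epsilon>)" for z
      using gauss_kernel_bounds[of \<epsilon> y z] gauss_kernel_bounds[of \<delta> y z] \<epsilon>\<delta> unfolding h_def by auto
    have "expectation (\<lambda>\<omega>. (?f \<delta> \<omega> - ?f \<epsilon> \<omega>)\<^sup>2) = expectation (\<lambda>\<omega>. (\<integral>s. h (X s \<omega>) \<partial>?N)\<^sup>2)"
      using kernel_int \<epsilon>\<delta> by (intro Bochner_Integration.integral_cong) (auto simp: approx_local_time_eq h_def)
    also have "ennreal \<dots> \<le> (\<integral>\<^sup>+s. \<integral>\<^sup>+r. ennreal \<bar>expectation (\<lambda>\<omega>. h (X s \<omega>) * h (X r \<omega>))\<bar> \<partial>?N \<partial>?N)"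
      using hb by (intro second_moment_integral_le finite_measure_axioms finN) auto
    also have "\<dots> \<le> ennreal (16 * (?C * \<delta> powr (1/4)))"
    proof (rule nn_integral_singular_kernel_restrict_le)
      show "ennreal \<bar>expectation (\<lambda>\<omega>. h (X s \<omega>) * h (X r \<omega>))\<bar> \<le> ennreal (?C * \<delta> powr (1/4) * singular_kernel s r)"
        if sr: "0 < s" "s < r" "r \<le> t" for s r
      proof -
        \<comment> \<open>The correlation bound has the later time first, which is \<open>r\<close>
          here.\<close>
        have "ennreal \<bar>expectation (\<lambda>\<omega>. h (X r \<omega>) * h (X s \<omega>))\<bar> \<le> ennreal (?C * \<delta> powr (1/4) * singular_kernel s r)"
          using sr t m \<epsilon>\<delta> by (intro gauss_kernel_diff_correlation_le[OF X X _ _ _ _ m_le m_le _ _ h_def]) auto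
        then show ?thesis by (simp only: mult.commute[of "h (X s _)"])
      qed
    qed (use t m in \<open>auto simp: mult.commute\<close>)
    finally show ?thesis
      using m by (simp add: ennreal_le_iff)
  qed
  \<comment> \<open>The squared distance is at most a constant times the power 1/4 of the larger
    parameter, a rate from which the mean square limit follows.\<close>
  have "\<exists>L. L2_tendsto M ?f L (at_right 0)"
    by (rule L2_limit_at_right_0[where p="1/4", OF sq _ incr]) auto
  then show "local_time_exists M X t y"
    by (simp add: local_time_exists_def is_local_time_def)
qed

end
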